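(* Consider the unbiased attitude estimation problem and the Riccati observer described in the context. Suppose that the angular velocity $\Omega(t)$ and the measurement directions $a_j^{(i)}(t)$ and $b_i(t)$ ($i=1,\dots,p$, $j=1,\dots,n_i$) are continuous and bounded on $[0,\infty)$, and that there exist constants $\delta,\mu>0$ such that for all $t\ge 0$ $$W^{A_\lambda^\star,C_\lambda^\star}(t,t+\delta):=-\frac{1}{\delta}\int_t^{t+\delta}\sum_{i=1}^p b_i(s)^\times R(s)\Lambda_i(s)\Lambda_i(s)^\top R^\top(s)\,b_i(s)^\times\,ds\ \succeq\ \mu I_3 .$$ Then the equilibrium $\tilde R=I_3$ of the attitude error $\tilde R:=\hat R R^\top$ is locally exponentially stable.
   Context: For $\omega\in\mathbb{R}^3$, $\omega^\times\in\mathbb{R}^{3\times 3}$ is the skew-symmetric matrix with $\omega^\times y=\omega\times y$ for all $y\in\mathbb{R}^3$. $\mathbf{SO}(3)$ is the group of $3\times3$ rotation matrices. For symmetric matrices, $X\succeq Y$ means $X-Y$ is positive semidefinite. System: $R(t)\in\mathbf{SO}(3)$ satisfies $\dot R=R\,\Omega^\times$ with $\Omega(t)\in\mathbb{R}^3$ known (there is no gyroscope bias). Outputs: for $i=1,\dots,p$, $y_i:=\Lambda_i^\top R^\top b_i\in\mathbb{R}^{n_i}$ with $n_i\ge1$ and $\Lambda_i:=[a_1^{(i)}\ \cdots\ a_{n_i}^{(i)}]\in\mathbb{R}^{3\times n_i}$, where $a_j^{(i)}(t)\in\mathbb{R}^3$ and $b_i(t)\in\mathbb{R}^3$ are known, possibly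 time-varying vectors; $m=\sum_{i=1}^p n_i$. Observer: $\dot{\hat R}=\hat R\,\Omega^\times+\Delta_R^\times\hat R$, $\hat R(0)\in\mathbf{SO}(3)$, with output errors $\tilde y_i:=\Lambda_i^\top\hat R^\top b_i-y_i$, stacked as $\bm y=(\tilde y_1,\dots,\tilde y_p)\in\mathbb{R}^m$. Let $C_i:=\Lambda_i^\top\hat R^\top b_i^\times\in\mathbb{R}^{n_i\times3}$ and let $C_\lambda\in\mathbb{R}^{m\times 3}$ be the vertical stack of $C_1,\dots,C_p$. The innovation is $\Delta_R=-P\,C_\lambda^\top Q\,\bm y$, where $P(t)\in\mathbb{R}^{3\times3}$ solves the continuous Riccati equation $\dot P=-P C_\lambda^\top Q C_\lambda P+V$ with $P(0)$ symmetric positive definite. Here $Q(t)\in\mathbb{R}^{m\times m}$ and $V(t)\in\mathbb{R}^{3\times3}$ are bounded continuous symmetric positive definite matrix-valued functions. The attitude error $\tilde R=\hat R R^\top$ satisfies $\dot{\tilde R}=\Delta_R^\times\tilde R$. Local exponential stability of $\tilde R=I_3$ means: there exist $r,c,\kappa>0$ such that $\|\tilde R(0)-I_3\|\le r$ implies $\|\tilde R(t)-I_3\|\le c\,e^{-\kappa t}\|\tilde R(0)-I_3\|$ for all $t\ge0$.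
   Formalization: Q(t) and V(t) are assumed uniformly positive definite (at least εI for all t ≥ 0, with some fixed ε > 0), not merely positive definite at each time; with pointwise positivity the claim fails, e.g. for V(t) = e^{-t} I. *)

theory Defs
  imports "HOL-Analysis.Analysis"
begin

definition cross_mat :: "real^3 \<Rightarrow> real^3^3" where
  "cross_mat w = matrix (cross3 w)"

lemma cross_mat_mult: "cross_mat w *v y = cross3 w y"
proof -
  have "linear (cross3 w)"
    by (rule linearI) (simp_all add: cross_add_right cross_mult_right)
  then show ?thesis
    by (simp add: cross_mat_def matrix_works)
qed

definition pos_semidef :: "real^'n^'n \<Rightarrow> bool" where
  "pos_semidef X \<longleftrightarrow> transpose X = X \<and> (\<forall>x. 0 \<le> x \<bullet> (X *v x))"

definition pos_def :: "real^'n^'n \<Rightarrow> bool" where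
  "pos_def X \<longleftrightarrow> transpose X = X \<and> (\<forall>x. x \<noteq> 0 \<longrightarrow> 0 < x \<bullet> (X *v x))"

definition loewner_ge :: "real^'n^'n \<Rightarrow> real^'n^'n \<Rightarrow> bool" where
  "loewner_ge X Y \<longleftrightarrow> pos_semidef (X - Y)"

text \<open>
  A time-varying matrix is called positive definite in the sense usual for time-varying Lyapunov
  and Riccati equations: it stays above a fixed positive multiple of the identity.
  Positive definiteness at each single time would not be enough for exponential stability,
  because a gain vanishing at infinity (such as \<open>V t = exp (- t) *\<^sub>R mat 1\<close>) destroys it.
\<close>
definition pos_def_fun :: "(real \<Rightarrow> real^'n^'n) \<Rightarrow> bool" where
  "pos_def_fun M \<longleftrightarrow> (\<exists>\<epsilon>>0. \<forall>t\<ge>0. loewner_ge (M t) (\<epsilon> *\<^sub>R mat 1))"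

definition bounded_continuous :: "(real \<Rightarrow> 'a::real_normed_vector) \<Rightarrow> bool" where
  "bounded_continuous f \<longleftrightarrow> continuous_on {0..} f \<and> bounded (f ` {0..})"

text \<open>
  \<open>\<Lambda>\<^sub>i\<close> is given by its columns \<open>a i 1, \<dots>, a i (n i)\<close>. The numbers of columns differ with \<open>i\<close>, so the
  stacked vectors and matrices use one finite row type \<open>'m\<close>, and \<open>idx\<close> sends a row of the stack to
  the pair \<open>(i, j)\<close> of its block and its position in that block.
\<close>
definition row_numbering :: "nat \<Rightarrow> (nat \<Rightarrow> nat) \<Rightarrow> ('m::finite \<Rightarrow> nat \<times> nat) \<Rightarrow> bool" where
  "row_numbering p n idx \<longleftrightarrow> bij_betw idx UNIV (SIGMA i:{1..p}. {1..n i})"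

text \<open>The stack of the vectors \<open>\<Lambda>\<^sub>i\<^sup>T X\<^sup>T b\<^sub>i\<close>.\<close>
definition output_stack ::
  "('m::finite \<Rightarrow> nat \<times> nat) \<Rightarrow> (nat \<Rightarrow> nat \<Rightarrow> real^3) \<Rightarrow> (nat \<Rightarrow> real^3) \<Rightarrow> real^3^3 \<Rightarrow> real^'m" where
  "output_stack idx a b X = (\<chi> k. case idx k of (i, j) \<Rightarrow> a i j \<bullet> (transpose X *v b i))"

text \<open>The stack of the matrices \<open>\<Lambda>\<^sub>i\<^sup>T X\<^sup>T b\<^sub>i\<^sup>\<times>\<close>.\<close>
definition C_stack ::
  "('m::finite \<Rightarrow> nat \<times> nat) \<Rightarrow> (nat \<Rightarrow> nat \<Rightarrow> real^3) \<Rightarrow> (nat \<Rightarrow> real^3) \<Rightarrow> real^3^3 \<Rightarrow> real^3^'m" where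
  "C_stack idx a b X = (\<chi> k. case idx k of (i, j) \<Rightarrow> a i j v* (transpose X ** cross_mat (b i)))"

text \<open>Here \<open>X\<close> stands for the estimate and \<open>R\<close> for the true attitude.\<close>
definition innovation ::
  "('m::finite \<Rightarrow> nat \<times> nat) \<Rightarrow> (nat \<Rightarrow> nat \<Rightarrow> real^3) \<Rightarrow> (nat \<Rightarrow> real^3)
    \<Rightarrow> real^'m^'m \<Rightarrow> real^3^3 \<Rightarrow> real^3^3 \<Rightarrow> real^3^3 \<Rightarrow> real^3" where
  "innovation idx a b Q P R X =
     - ((P ** transpose (C_stack idx a b X) ** Q) *v (output_stack idx a b X - output_stack idx a b R))"

definition attitude_system :: "(real \<Rightarrow> real^3) \<Rightarrow> (real \<Rightarrow> real^3^3) \<Rightarrow> bool" where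
  "attitude_system \<Omega> R \<longleftrightarrow>
     (\<forall>t\<ge>0. rotation_matrix (R t)) \<and>
     (\<forall>t\<ge>0. (R has_vector_derivative R t ** cross_mat (\<Omega> t)) (at t within {0..}))"

definition riccati_observer ::
  "('m::finite \<Rightarrow> nat \<times> nat) \<Rightarrow> (real \<Rightarrow> real^3) \<Rightarrow> (nat \<Rightarrow> nat \<Rightarrow> real \<Rightarrow> real^3) \<Rightarrow> (nat \<Rightarrow> real \<Rightarrow> real^3)
    \<Rightarrow> (real \<Rightarrow> real^'m^'m) \<Rightarrow> (real \<Rightarrow> real^3^3) \<Rightarrow> real^3^3 \<Rightarrow> (real \<Rightarrow> real^3^3)
    \<Rightarrow> (real \<Rightarrow> real^3^3) \<Rightarrow> (real \<Rightarrow> real^3^3) \<Rightarrow> bool" where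
  "riccati_observer idx \<Omega> a b Q V P\<^sub>0 R Rh P \<longleftrightarrow>
     rotation_matrix (Rh 0) \<and> P 0 = P\<^sub>0 \<and>
     (\<forall>t\<ge>0.
        let C = C_stack idx (\<lambda>i j. a i j t) (\<lambda>i. b i t) (Rh t);
            \<Delta> = innovation idx (\<lambda>i j. a i j t) (\<lambda>i. b i t) (Q t) (P t) (R t) (Rh t)
        in (Rh has_vector_derivative Rh t ** cross_mat (\<Omega> t) + cross_mat \<Delta> ** Rh t)
             (at t within {0..}) \<and>
           (P has_vector_derivative - (P t ** transpose C ** Q t ** C ** P t) + V t)
             (at t within {0..}))"

text \<open>The \<open>(r, s)\<close> entry of \<open>\<Lambda>\<^sub>i \<Lambda>\<^sub>i\<^sup>T\<close> is summed over the \<open>N\<close> columns.\<close>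
definition column_gram :: "nat \<Rightarrow> (nat \<Rightarrow> real^3) \<Rightarrow> real^3^3" where
  "column_gram N a = (\<chi> r s. \<Sum>j=1..N. a j $ r * a j $ s)"

definition obs_gramian ::
  "nat \<Rightarrow> (nat \<Rightarrow> nat) \<Rightarrow> (nat \<Rightarrow> nat \<Rightarrow> real \<Rightarrow> real^3) \<Rightarrow> (nat \<Rightarrow> real \<Rightarrow> real^3) \<Rightarrow> (real \<Rightarrow> real^3^3)
    \<Rightarrow> real \<Rightarrow> real \<Rightarrow> real^3^3" where
  "obs_gramian p n a b R t\<^sub>1 t\<^sub>2 =
     - (1 / (t\<^sub>2 - t\<^sub>1)) *\<^sub>R integral {t\<^sub>1..t\<^sub>2} (\<lambda>s. \<Sum>i=1..p.
         cross_mat (b i s) ** R s ** column_gram (n i) (\<lambda>j. a i j s) ** transpose (R s)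
           ** cross_mat (b i s))"

text \<open>The set \<open>\<X>\<close> consists of the trajectories, on the time interval \<open>{0..}\<close>.\<close>
definition locally_exp_stable :: "'a::real_normed_vector \<Rightarrow> (real \<Rightarrow> 'a) set \<Rightarrow> bool" where
  "locally_exp_stable e \<X> \<longleftrightarrow>
     (\<exists>r>0. \<exists>c>0. \<exists>\<kappa>>0. \<forall>x\<in>\<X>. norm (x 0 - e) \<le> r \<longrightarrow>
        (\<forall>t\<ge>0. norm (x t - e) \<le> c * exp (- \<kappa> * t) * norm (x 0 - e)))"

end

theory Submission
  imports Defs
begin

text \<open>
  Write \<open>E\<close> for the attitude error, \<open>M\<close> for the inverse of \<open>P\<close> and \<open>lam\<close> for the vector of the skew
  part of \<open>E\<close>. Since \<open>E\<close> is orthogonal, \<open>E - I\<close> and the cross product matrix of \<open>lam\<close> differ only by a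
  quadratic term, so \<open>lam' = - P C\<^sup>T Q C lam\<close> up to quadratic terms. As \<open>M' = C\<^sup>T Q C - M V M\<close>, the
  Lyapunov function \<open>L = lam \<bullet> M lam\<close> satisfies \<open>L' \<le> - (M lam) \<bullet> V (M lam)\<close> up to cubic terms.

  Exponential decay therefore needs uniform bounds on \<open>M\<close> from both sides. The upper bound on \<open>M\<close>
  is a lower bound on \<open>P\<close> and holds unconditionally. The lower bound on \<open>M\<close> comes from
  \<open>(x \<bullet> M x)' \<ge> x \<bullet> C\<^sup>T Q C x - k (x \<bullet> M x)\<close>, integrated over a window of length \<open>\<delta>\<close>. It needs
  observability of \<open>C\<close>, which depends on the estimate and inherits observability from the true
  attitude only while \<open>E\<close> is close to \<open>I\<close>. A continuity argument closes this circle: as long as \<open>E\<close>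
  has stayed close to \<open>I\<close>, the decay of \<open>L\<close> keeps it strictly closer.
\<close>

subsection \<open>Differential inequalities and matrix norms\<close>

lemma DERIV_within_nonneg_mono:
  fixes f f' :: "real \<Rightarrow> real"
  assumes "0 \<le> u" "u \<le> v"
    and der: "\<And>s. u \<le> s \<Longrightarrow> s \<le> v \<Longrightarrow> (f has_real_derivative f' s) (at s within {0..})"
    and nonneg: "\<And>s. u \<le> s \<Longrightarrow> s \<le> v \<Longrightarrow> 0 \<le> f' s"
  shows "f u \<le> f v"
proof -
  have "(f has_derivative (*) (f' s)) (at s within {u..v})" if "u \<le> s" "s \<le> v" for s
    by (rule has_derivative_subset[OF der[OF that, unfolded has_field_derivative_def]])
      (use \<open>0 \<le> u\<close> in auto)
  then obtain s where "s \<in> {u..v}" "f v - f u = f' s * (v - u)"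
    using mvt_very_simple[OF \<open>u \<le> v\<close>, of f "\<lambda>s. (*) (f' s)"] by blast
  moreover from this have "0 \<le> f' s * (v - u)"
    using nonneg \<open>u \<le> v\<close> by simp
  ultimately show ?thesis by simp
qed

lemma differential_Gronwall:
  fixes f f' :: "real \<Rightarrow> real"
  assumes "0 \<le> u" "u \<le> v"
    and der: "\<And>s. u \<le> s \<Longrightarrow> s \<le> v \<Longrightarrow> (f has_real_derivative f' s) (at s within {0..})"
    and le: "\<And>s. u \<le> s \<Longrightarrow> s \<le> v \<Longrightarrow> f' s \<le> k * f s"
  shows "f v \<le> exp (k * (v - u)) * f u"
proof -
  \<comment> \<open>Integrating factor: \<open>exp (- k * s) * f s\<close> is nonincreasing. The
    sign is flipped to match the monotonicity lemma.\<close>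
  have "- (exp (- k * u) * f u) \<le> - (exp (- k * v) * f v)"
  proof (rule DERIV_within_nonneg_mono[OF assms(1,2)])
    fix s assume s: "u \<le> s" "s \<le> v"
    show "((\<lambda>s. - (exp (- k * s) * f s)) has_real_derivative exp (- k * s) * (k * f s - f' s))
        (at s within {0..})"
      by (rule derivative_eq_intros der[OF s] refl | simp add: algebra_simps)+
    show "0 \<le> exp (- k * s) * (k * f s - f' s)"
      using le[OF s] by simp
  qed
  then have "exp (k * v) * (exp (- k * v) * f v) \<le> exp (k * v) * (exp (- k * u) * f u)"
    by simp
  moreover have "exp (k * v) * exp (- k * v) = 1" "exp (k * v) * exp (- k * u) = exp (k * (v - u))"
    by (simp_all add: algebra_simps flip: exp_add)
  ultimately show ?thesis
    by (metis mult.assoc mult_1)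
qed

section \<open>Frobenius norms, bilinearity of matrix products, quadratic forms\<close>

lemma inner_matrix_transpose: "(A *v x) \<bullet> y = x \<bullet> (transpose A *v y)" for A :: "real^'n^'m"
  by (metis dot_lmul_matrix inner_commute transpose_matrix_vector)

lemma inner_symmetric_matrix:
  fixes A :: "real^'n^'n"
  assumes "transpose A = A"
  shows "(A *v x) \<bullet> y = x \<bullet> (A *v y)"
  using inner_matrix_transpose[of A x y] assms by simp

lemma norm_matrix_vector_mult_le: "norm (A *v x) \<le> norm A * norm x" for A :: "real^'n^'m"
proof -
  have "norm (A *v x) = L2_set (\<lambda>i. norm (A $ i \<bullet> x)) UNIV"
    by (simp add: norm_vec_def matrix_mult_dot)
  also have "\<dots> \<le> L2_set (\<lambda>i. norm (A $ i) * norm x) UNIV"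
    by (rule L2_set_mono) (simp_all add: Cauchy_Schwarz_ineq2)
  also have "\<dots> = norm A * norm x"
    by (simp add: norm_vec_def L2_set_left_distrib)
  finally show ?thesis .
qed

lemma norm_transpose: "norm (transpose A) = norm A" for A :: "real^'n^'m"
proof -
  have "transpose A \<bullet> transpose A = A \<bullet> A"
    unfolding inner_vec_def transpose_def by (simp add: sum.swap[of _ "UNIV::'n set"])
  then show ?thesis by (simp add: norm_eq_sqrt_inner)
qed

lemma norm_matrix_matrix_mult_le: "norm (A ** B) \<le> norm A * norm B"
  for A :: "real^'n^'m" and B :: "real^'l^'n"
proof -
  have row: "(A ** B) $ i = transpose B *v (A $ i)" for i
    by (simp add: vec_eq_iff matrix_matrix_mult_def matrix_vector_mult_def transpose_def
        mult.commute)
  have "norm (A ** B) = L2_set (\<lambda>i. norm (transpose B *v (A $ i))) UNIV"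
    by (subst norm_vec_def) (simp add: row)
  also have "\<dots> \<le> L2_set (\<lambda>i. norm (A $ i) * norm B) UNIV"
    by (rule L2_set_mono)
      (use norm_matrix_vector_mult_le[of "transpose B"] norm_transpose[of B] in
        \<open>simp_all add: mult.commute[of _ "norm B"]\<close>)
  also have "\<dots> = norm A * norm B"
    by (simp add: norm_vec_def[of A] L2_set_left_distrib)
  finally show ?thesis .
qed

text \<open>Pairing the image with itself moves \<open>A\<close> back to the left, where the bound
  applies. This keeps the constant \<open>c\<close>, whereas a detour through the Frobenius norm
  would cost a dimension factor.\<close>

lemma norm_transpose_mult_le:
  fixes A :: "real^'n^'m"
  assumes le: "\<And>x. norm (A *v x) \<le> c * norm x"
  shows "norm (transpose A *v y) \<le> c * norm y"
proof (cases "transpose A *v y = 0")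
  case True
  have "0 \<le> c * norm (axis undefined 1 :: real^'n)"
    using norm_ge_zero le by (rule order_trans)
  then show ?thesis using True by simp
next
  case False
  let ?z = "transpose A *v y"
  have "norm ?z * norm ?z = (A *v ?z) \<bullet> y"
    by (simp add: inner_matrix_transpose power2_norm_eq_inner flip: power2_eq_square)
  also have "\<dots> \<le> norm (A *v ?z) * norm y"
    by (rule norm_cauchy_schwarz)
  also have "\<dots> \<le> c * norm ?z * norm y"
    by (intro mult_right_mono le norm_ge_zero)
  finally show ?thesis
    using False by (simp add: mult.assoc mult.left_commute)
qed

lemma bounded_bilinear_matrix_vector_mult: "bounded_bilinear ((*v) :: real^'n^'m \<Rightarrow> _)"
  by standard
    (auto simp: matrix_vector_mult_add_rdistrib matrix_vector_right_distrib
      scaleR_matrix_vector_assoc matrix_vector_mult_scaleR norm_matrix_vector_mult_le intro!: exI[of _ 1])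

lemma bounded_bilinear_matrix_matrix_mult:
  "bounded_bilinear ((**) :: real^'n^'m \<Rightarrow> real^'l^'n \<Rightarrow> real^'l^'m)"
proof
  fix A A' :: "real^'n^'m" and B B' :: "real^'l^'n" and r :: real
  show "(A + A') ** B = A ** B + A' ** B"
    by (simp add: vec_eq_iff matrix_matrix_mult_def sum.distrib distrib_right)
  show "A ** (B + B') = A ** B + A ** B'"
    by (simp add: matrix_add_ldistrib)
  show "r *\<^sub>R A ** B = r *\<^sub>R (A ** B)" "A ** r *\<^sub>R B = r *\<^sub>R (A ** B)"
    by (simp_all add: vec_eq_iff matrix_matrix_mult_def sum_distrib_left mult.assoc mult.left_commute)
  show "\<exists>K. \<forall>(A :: real^'n^'m) (B :: real^'l^'n). norm (A ** B) \<le> norm A * norm B * K"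
    by (intro exI[of _ 1]) (simp add: norm_matrix_matrix_mult_le)
qed

lemmas has_vector_derivative_matrix_vector_mult =
  bounded_bilinear.has_vector_derivative[OF bounded_bilinear_matrix_vector_mult]
lemmas has_vector_derivative_matrix_mult =
  bounded_bilinear.has_vector_derivative[OF bounded_bilinear_matrix_matrix_mult]
lemmas has_vector_derivative_inner =
  bounded_bilinear.has_vector_derivative[OF bounded_bilinear_inner]
lemmas has_vector_derivative_inner_const_left =
  bounded_linear.has_vector_derivative[OF bounded_linear_inner_right]

lemma bounded_linear_transpose: "bounded_linear (transpose :: real^'n^'m \<Rightarrow> real^'m^'n)"
  by (rule bounded_linear_intro[where K = 1])
    (simp_all add: norm_transpose, simp_all add: vec_eq_iff transpose_def)

lemma has_vector_derivative_quadratic_form: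
  fixes A :: "real \<Rightarrow> real^'n^'n"
  assumes "(A has_vector_derivative A') (at t within S)"
  shows "((\<lambda>t. x \<bullet> (A t *v x)) has_real_derivative x \<bullet> (A' *v x)) (at t within S)"
  unfolding has_real_derivative_iff_has_vector_derivative
  using has_vector_derivative_inner_const_left[OF
      has_vector_derivative_matrix_vector_mult[OF assms has_vector_derivative_const], of x x]
  by simp

text \<open>A zero of a nonnegative quadratic form is a minimum, so the gradient, twice
  \<open>A *v x\<close>, vanishes: otherwise a small step against it would make the form
  negative.\<close>

lemma semidefinite_kernel:
  fixes A :: "real^'n^'n"
  assumes sym: "transpose A = A" and nonneg: "\<And>y. 0 \<le> y \<bullet> (A *v y)"
    and zero: "x \<bullet> (A *v x) = 0"
  shows "A *v x = 0"
proof (rule ccontr)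
  define z where "z = A *v x"
  assume "A *v x \<noteq> 0"
  then have pos: "0 < z \<bullet> z" by (simp add: z_def)
  \<comment> \<open>Almost the minimizer of the parabola in \<tau>. The summand 1 keeps the
    denominator positive when \<open>z \<bullet> (A *v z)\<close> is 0, and it still gives
    \<open>\<tau> * (z \<bullet> (A *v z)) \<le> z \<bullet> z\<close>, half of what nonnegativity
    demands.\<close>
  define \<tau> where "\<tau> = z \<bullet> z / (1 + z \<bullet> (A *v z))"
  have d: "0 < 1 + z \<bullet> (A *v z)" using nonneg[of z] by simp
  then have \<tau>: "0 < \<tau>" using pos by (simp add: \<tau>_def)
  have "x \<bullet> (A *v z) = z \<bullet> z"
    using inner_symmetric_matrix[OF sym, of x z] by (simp add: z_def)
  moreover have "0 \<le> (x - \<tau> *\<^sub>R z) \<bullet> (A *v (x - \<tau> *\<^sub>R z))"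
    by (rule nonneg)
  ultimately have "0 \<le> \<tau> * (\<tau> * (z \<bullet> (A *v z)) - 2 * (z \<bullet> z))"
    using zero
    by (simp add: matrix_vector_mult_diff_distrib matrix_vector_mult_scaleR inner_diff_left
        inner_diff_right z_def[symmetric] algebra_simps)
  then have "2 * (z \<bullet> z) \<le> \<tau> * (z \<bullet> (A *v z))"
    using \<tau> by (simp add: zero_le_mult_iff)
  also have "\<dots> \<le> \<tau> * (1 + z \<bullet> (A *v z))"
    using \<tau> by simp
  also have "\<dots> = z \<bullet> z"
    using d by (simp add: \<tau>_def)
  finally show False using pos by simp
qed

lemmas matrix_vector_mult_minus_left =
  bounded_bilinear.minus_left[OF bounded_bilinear_matrix_vector_mult]
lemmas matrix_mult_add_left =
  bounded_bilinear.add_left[OF bounded_bilinear_matrix_matrix_mult]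
lemmas matrix_mult_add_right =
  bounded_bilinear.add_right[OF bounded_bilinear_matrix_matrix_mult]
lemmas matrix_mult_minus_left =
  bounded_bilinear.minus_left[OF bounded_bilinear_matrix_matrix_mult]
lemmas matrix_mult_minus_right =
  bounded_bilinear.minus_right[OF bounded_bilinear_matrix_matrix_mult]
lemmas matrix_mult_diff_left =
  bounded_bilinear.diff_left[OF bounded_bilinear_matrix_matrix_mult]
lemmas matrix_mult_diff_right =
  bounded_bilinear.diff_right[OF bounded_bilinear_matrix_matrix_mult]
lemmas matrix_mult_scaleR_left =
  bounded_bilinear.scaleR_left[OF bounded_bilinear_matrix_matrix_mult]
lemmas matrix_mult_scaleR_right =
  bounded_bilinear.scaleR_right[OF bounded_bilinear_matrix_matrix_mult]

lemma quadratic_form_ge: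
  fixes A :: "real^'n^'n"
  assumes unit: "\<And>y. norm y = 1 \<Longrightarrow> c \<le> y \<bullet> (A *v y)"
  shows "c * (x \<bullet> x) \<le> x \<bullet> (A *v x)"
proof (cases "x = 0")
  case False
  then have "c \<le> (x /\<^sub>R norm x) \<bullet> (A *v (x /\<^sub>R norm x))"
    by (intro unit) simp
  then have "c * (norm x * norm x) \<le> x \<bullet> (A *v x)"
    using False by (simp add: matrix_vector_mult_scaleR field_simps)
  then show ?thesis by (simp add: dot_square_norm power2_eq_square)
qed simp

subsection \<open>Riccati equations\<close>

text \<open>The difference \<open>?D\<close> of \<open>P\<close> and its transpose has derivative
  \<open>- ?K\<close>, which is linear in \<open>?D\<close> once \<open>P\<close> is regarded as a
  known coefficient. As \<open>?D\<close> starts at 0, Gronwall applied to its squared norm keeps it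
  there.\<close>

lemma riccati_symmetric:
  fixes P G V :: "real \<Rightarrow> real^'n^'n"
  assumes der: "\<And>t. 0 \<le> t \<Longrightarrow>
      (P has_vector_derivative - (P t ** G t ** P t) + V t) (at t within {0..})"
    and symG: "\<And>t. 0 \<le> t \<Longrightarrow> transpose (G t) = G t"
    and symV: "\<And>t. 0 \<le> t \<Longrightarrow> transpose (V t) = V t"
    and sym0: "transpose (P 0) = P 0"
    and G_le: "\<And>t. 0 \<le> t \<Longrightarrow> norm (G t) \<le> g"
    and "0 \<le> T"
  shows "transpose (P T) = P T"
proof -
  let ?D = "\<lambda>t. P t - transpose (P t)"
  let ?K = "\<lambda>t. ?D t ** G t ** P t + transpose (P t) ** G t ** ?D t"
  have cont: "continuous_on {0..} P"
    using der by (intro continuous_on_vector_derivative) auto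
  have "compact (P ` {0..T})"
    by (rule compact_continuous_image[OF continuous_on_subset[OF cont]]) auto
  then obtain q where q: "\<And>t. 0 \<le> t \<Longrightarrow> t \<le> T \<Longrightarrow> norm (P t) \<le> q"
    by (force simp: bounded_iff dest: compact_imp_bounded)
  have Dder: "(?D has_vector_derivative - ?K t) (at t within {0..})" if "0 \<le> t" for t
  proof -
    have "((\<lambda>t. transpose (P t)) has_vector_derivative
        transpose (- (P t ** G t ** P t) + V t)) (at t within {0..})"
      by (rule bounded_linear.has_vector_derivative[OF bounded_linear_transpose der[OF that]])
    also have "transpose (- (P t ** G t ** P t) + V t)
        = - (transpose (P t) ** G t ** transpose (P t)) + V t"
      using symG[OF that] symV[OF that]
        linear_add[OF bounded_linear.linear[OF bounded_linear_transpose], of "- (P t ** G t ** P t)" "V t"]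
        linear_neg[OF bounded_linear.linear[OF bounded_linear_transpose], of "P t ** G t ** P t"]
      by (simp add: matrix_transpose_mul matrix_mul_assoc)
    finally have "(?D has_vector_derivative (- (P t ** G t ** P t) + V t)
        - (- (transpose (P t) ** G t ** transpose (P t)) + V t)) (at t within {0..})"
      by (intro has_vector_derivative_diff der[OF that])
    moreover have "(- (P t ** G t ** P t) + V t)
        - (- (transpose (P t) ** G t ** transpose (P t)) + V t) = - ?K t"
      by (simp add: matrix_mult_diff_left matrix_mult_diff_right)
    ultimately show ?thesis by (simp only:)
  qed
  \<comment> \<open>Both summands of \<open>?K\<close> are at most
    \<open>q * g * norm (?D t)\<close>, and differentiating the square doubles their sum: hence the
    factor 4.\<close>
  have "?D T \<bullet> ?D T \<le> exp (4 * q * g * (T - 0)) * (?D 0 \<bullet> ?D 0)"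
  proof (rule differential_Gronwall[OF order_refl \<open>0 \<le> T\<close>])
    fix t assume t: "0 \<le> t" "t \<le> T"
    show "((\<lambda>t. ?D t \<bullet> ?D t) has_real_derivative ?D t \<bullet> - ?K t + - ?K t \<bullet> ?D t)
        (at t within {0..})"
      unfolding has_real_derivative_iff_has_vector_derivative
      by (rule has_vector_derivative_inner[OF Dder Dder]) (use t in auto)
    have gq: "0 \<le> g" "0 \<le> q"
      using order_trans[OF norm_ge_zero G_le[OF t(1)]] order_trans[OF norm_ge_zero q[OF t]] .
    have triple: "norm (A ** B ** C) \<le> norm A * norm B * norm C" for A B C :: "real^'n^'n"
      by (rule order_trans[OF norm_matrix_matrix_mult_le])
        (intro mult_right_mono norm_matrix_matrix_mult_le norm_ge_zero)
    have "norm (?D t ** G t ** P t) \<le> norm (?D t) * g * q"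
      by (rule order_trans[OF triple])
        (intro mult_mono order_refl G_le q t mult_nonneg_nonneg norm_ge_zero gq)
    moreover have "norm (transpose (P t) ** G t ** ?D t) \<le> q * g * norm (?D t)"
      by (rule order_trans[OF triple], unfold norm_transpose)
        (intro mult_mono order_refl G_le q t mult_nonneg_nonneg norm_ge_zero gq)
    ultimately have "norm (?K t) \<le> 2 * q * g * norm (?D t)"
      by (intro order_trans[OF norm_triangle_ineq]) (simp add: mult_ac)
    moreover have "D \<bullet> - K + - K \<bullet> D \<le> 2 * c * (D \<bullet> D)" if "norm K \<le> c * norm D"
      for D K :: "real^'n^'n" and c
    proof -
      have "D \<bullet> - K \<le> norm D * norm K"
        using norm_cauchy_schwarz[of D "- K"] by simp
      also have "\<dots> \<le> norm D * (c * norm D)"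
        using that by (intro mult_left_mono) auto
      finally show ?thesis
        by (simp add: inner_commute[of K] dot_square_norm power2_eq_square mult_ac)
    qed
    ultimately have "?D t \<bullet> - ?K t + - ?K t \<bullet> ?D t \<le> 2 * (2 * q * g) * (?D t \<bullet> ?D t)"
      by blast
    then show "?D t \<bullet> - ?K t + - ?K t \<bullet> ?D t \<le> 4 * q * g * (?D t \<bullet> ?D t)"
      by simp
  qed
  then have "?D T \<bullet> ?D T \<le> 0"
    using sym0 by simp
  then have "?D T = 0"
    by (metis antisym inner_eq_zero_iff inner_ge_zero)
  then show ?thesis by simp
qed

text \<open>At the first time at which the least eigenvalue of \<open>P\<close> equals \<open>\<epsilon>\<close>, a corresponding unit
  eigenvector \<open>x\<close> has \<open>x \<bullet> P' x \<ge> v - \<epsilon>\<^sup>2 g > 0\<close>, so the least eigenvalue was smaller just before.\<close>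
lemma riccati_lower_bound:
  fixes P G V :: "real \<Rightarrow> real^'n^'n"
  assumes der: "\<And>t. 0 \<le> t \<Longrightarrow>
      (P has_vector_derivative - (P t ** G t ** P t) + V t) (at t within {0..})"
    and sym: "\<And>t. 0 \<le> t \<Longrightarrow> transpose (P t) = P t"
    and G_le: "\<And>t x. 0 \<le> t \<Longrightarrow> x \<bullet> (G t *v x) \<le> g * (x \<bullet> x)"
    and V_ge: "\<And>t x. 0 \<le> t \<Longrightarrow> v * (x \<bullet> x) \<le> x \<bullet> (V t *v x)"
    and P0: "\<And>x. norm x = 1 \<Longrightarrow> \<epsilon> < x \<bullet> (P 0 *v x)"
    and small: "\<epsilon>\<^sup>2 * g < v"
    and "0 \<le> T"
  shows "\<epsilon> * (x \<bullet> x) \<le> x \<bullet> (P T *v x)"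
proof -
  have unit: "\<epsilon> < x \<bullet> (P T *v x)" if x: "norm x = 1" for x
  proof (rule ccontr)
    assume bad: "\<not> \<epsilon> < x \<bullet> (P T *v x)"
    let ?K = "{0..T} \<times> sphere 0 1 :: (real \<times> (real^'n)) set"
    let ?q = "\<lambda>z :: real \<times> (real^'n). snd z \<bullet> (P (fst z) *v snd z)"
    have "continuous_on {0..} P"
      using der by (intro continuous_on_vector_derivative) auto
    then have cP: "continuous_on ?K (\<lambda>z. P (fst z))"
      by (rule continuous_on_compose2) (auto intro: continuous_intros)
    have cq: "continuous_on ?K ?q"
      by (rule continuous_on_inner[OF continuous_on_snd[OF continuous_on_id]
            bounded_bilinear.continuous_on[OF bounded_bilinear_matrix_vector_mult cP
              continuous_on_snd[OF continuous_on_id]]])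
    have cK: "compact ?K"
      by (rule compact_Times) auto
    \<comment> \<open>The times at which some unit vector violates the bound. As the projection of a
      compact set of pairs of a time and a vector, \<open>B\<close> is compact and has a first
      element.\<close>
    define B where "B = fst ` {z \<in> ?K. ?q z \<le> \<epsilon>}"
    have "compact (?K \<inter> (?K \<inter> ?q -` {..\<epsilon>}))"
      by (rule compact_Int_closed[OF cK continuous_closed_preimage[OF cq compact_imp_closed[OF cK]]])
        simp
    also have "?K \<inter> (?K \<inter> ?q -` {..\<epsilon>}) = {z \<in> ?K. ?q z \<le> \<epsilon>}" by auto
    finally have "compact {z \<in> ?K. ?q z \<le> \<epsilon>}" .
    then have "compact B"
      unfolding B_def by (rule compact_continuous_image[OF continuous_on_fst[OF continuous_on_id]])
    moreover have "T \<in> B"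
      unfolding B_def by (rule image_eqI[of _ _ "(T, x)"]) (use bad x \<open>0 \<le> T\<close> in auto)
    then have "B \<noteq> {}" by blast
    ultimately obtain t where t: "t \<in> B" and first: "\<And>s. s \<in> B \<Longrightarrow> t \<le> s"
      using compact_attains_inf[of B] by blast
    from t obtain y where y: "norm y = 1" "y \<bullet> (P t *v y) \<le> \<epsilon>" and t0: "0 \<le> t" "t \<le> T"
      by (auto simp: B_def)
    have before: "\<epsilon> < z \<bullet> (P s *v z)" if "0 \<le> s" "s < t" "norm z = 1" for s z
    proof (rule ccontr)
      assume "\<not> \<epsilon> < z \<bullet> (P s *v z)"
      then have "s \<in> B"
        unfolding B_def by (intro image_eqI[of _ _ "(s, z)"]) (use that t0 in auto)
      from first[OF this] \<open>s < t\<close> show False by simp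
    qed
    have "0 < t"
      using P0[OF y(1)] y(2) t0(1) by (cases "t = 0") auto
    have qder: "((\<lambda>s. z \<bullet> (P s *v z)) has_real_derivative
        z \<bullet> ((- (P t ** G t ** P t) + V t) *v z)) (at t within {0..})" for z
      by (rule has_vector_derivative_quadratic_form[OF der[OF t0(1)]])
    \<comment> \<open>The strict inequality before \<open>t\<close> passes to the limit from the
      left as a weak one; \<open>0 < t\<close> makes this limit nontrivial.\<close>
    have ge: "\<epsilon> * (z \<bullet> z) \<le> z \<bullet> (P t *v z)" for z
    proof -
      have "\<epsilon> \<le> z \<bullet> (P t *v z)" if "norm z = 1" for z
      proof -
        have "((\<lambda>s. z \<bullet> (P s *v z)) \<longlongrightarrow> z \<bullet> (P t *v z)) (at t within {0..<t})"
          by (rule tendsto_within_subset[OF DERIV_continuous[OF qder[of z], unfolded continuous_within]])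
            auto
        moreover have "at t within {0..<t} \<noteq> bot"
          using \<open>0 < t\<close> by (simp add: trivial_limit_within islimpt_Ico)
        ultimately show ?thesis
          by (intro tendsto_lowerbound[where F = "at t within {0..<t}"])
            (auto simp: eventually_at_filter before that intro!: less_imp_le always_eventually)
      qed
      then show ?thesis by (rule quadratic_form_ge)
    qed
    have yy: "y \<bullet> y = 1" using y(1) by (simp add: dot_square_norm)
    have mul: "(P t - \<epsilon> *\<^sub>R mat 1) *v z = P t *v z - \<epsilon> *\<^sub>R z" for z
      by (simp add: matrix_vector_mult_diff_rdistrib scaleR_matrix_vector_assoc[symmetric])
    have "transpose (P t - \<epsilon> *\<^sub>R mat 1) = transpose (P t) - \<epsilon> *\<^sub>R mat 1"
      by (simp add: vec_eq_iff transpose_def mat_def)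
    then have "transpose (P t - \<epsilon> *\<^sub>R mat 1) = P t - \<epsilon> *\<^sub>R mat 1"
      using sym[OF t0(1)] by simp
    \<comment> \<open>The shifted matrix is positive semidefinite and its form vanishes at
      \<open>y\<close>, so \<open>y\<close> lies in its kernel. Being an eigenvector,
      \<open>y\<close> lets the quadratic term \<open>P G P\<close> be evaluated through
      \<open>G\<close> at \<open>y\<close> alone.\<close>
    then have "(P t - \<epsilon> *\<^sub>R mat 1) *v y = 0"
    proof (rule semidefinite_kernel)
      show "0 \<le> z \<bullet> ((P t - \<epsilon> *\<^sub>R mat 1) *v z)" for z
        using ge[of z] by (simp only: mul inner_diff_right) simp
      show "y \<bullet> ((P t - \<epsilon> *\<^sub>R mat 1) *v y) = 0"
        using ge[of y] y(2) yy by (simp only: mul inner_diff_right) simp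
    qed
    then have eig: "P t *v y = \<epsilon> *\<^sub>R y"
      by (simp add: mul)
    have "y \<bullet> ((P t ** G t ** P t) *v y) = (P t *v y) \<bullet> (G t *v (P t *v y))"
      by (simp add: inner_symmetric_matrix[OF sym[OF t0(1)]] flip: matrix_vector_mul_assoc)
    also have "\<dots> = \<epsilon>\<^sup>2 * (y \<bullet> (G t *v y))"
      by (simp add: eig matrix_vector_mult_scaleR power2_eq_square)
    also have "\<dots> \<le> \<epsilon>\<^sup>2 * g"
      using G_le[OF t0(1), of y] yy by (intro mult_left_mono) auto
    finally have "0 < y \<bullet> ((- (P t ** G t ** P t) + V t) *v y)"
      using V_ge[OF t0(1), of y] yy small
      unfolding matrix_vector_mult_add_rdistrib matrix_vector_mult_minus_left inner_add_right
      by simp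
    moreover have "DERIV (\<lambda>s. y \<bullet> (P s *v y)) t :> y \<bullet> ((- (P t ** G t ** P t) + V t) *v y)"
      using qder[of y] \<open>0 < t\<close> at_within_interior[of t "{0..}"] by simp
    ultimately obtain d where "0 < d" and
      d: "\<And>h. 0 < h \<Longrightarrow> h < d \<Longrightarrow> y \<bullet> (P (t - h) *v y) < y \<bullet> (P t *v y)"
      using DERIV_pos_inc_left by blast
    \<comment> \<open>The first entry stays inside the interval of increase, the second keeps
      \<open>t - ?h\<close> nonnegative.\<close>
    let ?h = "min (d / 2) t"
    have "y \<bullet> (P (t - ?h) *v y) < \<epsilon>"
      using d[of ?h] \<open>0 < d\<close> \<open>0 < t\<close> y(2) by linarith
    with before[of "t - ?h" y] \<open>0 < d\<close> \<open>0 < t\<close> y(1) show False by simp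
  qed
  show ?thesis
    by (rule quadratic_form_ge) (use unit in \<open>auto intro: less_imp_le\<close>)
qed

section \<open>Inverses of positive definite matrices and their derivatives\<close>

lemma norm_matrix_le:
  fixes A :: "real^'n^'m"
  assumes le: "\<And>x. norm (A *v x) \<le> c * norm x"
  shows "norm A \<le> real CARD('n) * c"
proof -
  have row_le: "norm (transpose A $ i) \<le> c" for i
    using le[of "axis i 1"] by (simp add: matrix_vector_mult_basis row_def column_def transpose_def)
  have "norm A = L2_set (\<lambda>i. norm (transpose A $ i)) UNIV"
    by (simp flip: norm_transpose[of A] norm_vec_def)
  also have "\<dots> \<le> (\<Sum>i\<in>UNIV. norm (transpose A $ i))"
    by (rule L2_set_le_sum) simp
  also have "\<dots> \<le> (\<Sum>i\<in>(UNIV :: 'n set). c)"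
    by (rule sum_mono) (rule row_le)
  finally show ?thesis by simp
qed

text \<open>Coercivity makes the kernel trivial. Tested at \<open>matrix_inv P *v x\<close> it
  yields the quadratic bound, and Cauchy-Schwarz turns this into the norm bound.\<close>

lemma pos_def_matrix_inv:
  fixes P :: "real^'n^'n"
  assumes sym: "transpose P = P" and "0 < c" and ge: "\<And>x. c * (x \<bullet> x) \<le> x \<bullet> (P *v x)"
  shows "P ** matrix_inv P = mat 1" "matrix_inv P ** P = mat 1"
    and "transpose (matrix_inv P) = matrix_inv P"
    and "c * (norm (matrix_inv P *v x))\<^sup>2 \<le> x \<bullet> (matrix_inv P *v x)"
    and "norm (matrix_inv P *v x) \<le> norm x / c"
    and "norm (matrix_inv P) \<le> real CARD('n) / c"
proof -
  have "x = 0" if "P *v x = 0" for x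
    using ge[of x] that \<open>0 < c\<close> by (simp add: mult_le_0_iff) (metis antisym inner_eq_zero_iff inner_ge_zero)
  then have "invertible P"
    by (simp add: invertible_left_inverse matrix_left_invertible_ker)
  then have "\<exists>B. P ** B = mat 1 \<and> B ** P = mat 1"
    by (simp add: invertible_def)
  then have inv: "P ** matrix_inv P = mat 1 \<and> matrix_inv P ** P = mat 1"
    unfolding matrix_inv_def by (rule someI_ex)
  then show r: "P ** matrix_inv P = mat 1" and l: "matrix_inv P ** P = mat 1" by auto
  have "transpose (matrix_inv P) ** P = mat 1"
    using arg_cong[OF r, of transpose] by (simp add: matrix_transpose_mul sym transpose_mat)
  then show symM: "transpose (matrix_inv P) = matrix_inv P"
    by (metis r matrix_mul_assoc matrix_mul_lid matrix_mul_rid)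
  have quad: "c * (norm (matrix_inv P *v x))\<^sup>2 \<le> x \<bullet> (matrix_inv P *v x)" for x
    using ge[of "matrix_inv P *v x"]
    by (simp add: matrix_vector_mul_assoc r dot_square_norm inner_commute)
  then show "c * (norm (matrix_inv P *v x))\<^sup>2 \<le> x \<bullet> (matrix_inv P *v x)" .
  have le: "norm (matrix_inv P *v x) \<le> norm x / c" for x
  proof (cases "matrix_inv P *v x = 0")
    case False
    have "c * (norm (matrix_inv P *v x) * norm (matrix_inv P *v x))
        \<le> norm x * norm (matrix_inv P *v x)"
      using quad[of x] norm_cauchy_schwarz[of x "matrix_inv P *v x"] by (simp add: power2_eq_square)
    then show ?thesis using False \<open>0 < c\<close> by (simp add: field_simps)
  qed (use \<open>0 < c\<close> in simp)
  then show "norm (matrix_inv P *v x) \<le> norm x / c" .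
  have "norm (matrix_inv P *v x) \<le> 1 / c * norm x" for x
    using le by simp
  then have "norm (matrix_inv P) \<le> real CARD('n) * (1 / c)"
    by (rule norm_matrix_le)
  then show "norm (matrix_inv P) \<le> real CARD('n) / c"
    by simp
qed

lemma has_vector_derivative_within_quotient:
  "(f has_vector_derivative f') (at x within S) \<longleftrightarrow>
    ((\<lambda>y. (f y - f x) /\<^sub>R (y - x)) \<longlongrightarrow> f') (at x within S)"
proof -
  have "norm ((f y - f x) - (y - x) *\<^sub>R f') / norm (y - x) = norm ((f y - f x) /\<^sub>R (y - x) - f')"
    if "y \<noteq> x" for y
  proof -
    have "(f y - f x) /\<^sub>R (y - x) - f' = ((f y - f x) - (y - x) *\<^sub>R f') /\<^sub>R (y - x)"
      using that by (simp add: scaleR_diff_right)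
    then show ?thesis by (simp add: divide_inverse mult.commute)
  qed
  then have "((\<lambda>y. norm ((f y - f x) - (y - x) *\<^sub>R f') / norm (y - x)) \<longlongrightarrow> 0) (at x within S) \<longleftrightarrow>
      ((\<lambda>y. norm ((f y - f x) /\<^sub>R (y - x) - f')) \<longlongrightarrow> 0) (at x within S)"
    by (intro tendsto_cong) (auto simp: eventually_at_filter)
  then show ?thesis
    by (simp add: has_vector_derivative_def has_derivative_iff_norm bounded_linear_scaleR_left
        tendsto_norm_zero_iff LIM_zero_iff)
qed

text \<open>The resolvent-type identity \<open>diff\<close> does the work twice: with the uniform
  bound \<open>c\<close> it gives continuity of the inverse, and divided by \<open>s - t\<close> it
  gives the derivative.\<close>

lemma has_vector_derivative_matrix_inv:
  fixes P :: "real \<Rightarrow> real^'n^'n"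
  assumes der: "(P has_vector_derivative P') (at t within S)" and "t \<in> S"
    and inv: "\<And>s. s \<in> S \<Longrightarrow> P s ** matrix_inv (P s) = mat 1"
      "\<And>s. s \<in> S \<Longrightarrow> matrix_inv (P s) ** P s = mat 1"
    and bounded: "\<And>s. s \<in> S \<Longrightarrow> norm (matrix_inv (P s)) \<le> c"
  shows "((\<lambda>s. matrix_inv (P s)) has_vector_derivative - (matrix_inv (P t) ** P' ** matrix_inv (P t)))
    (at t within S)"
proof -
  let ?M = "\<lambda>s. matrix_inv (P s)"
  have diff: "?M s - ?M t = - (?M s ** (P s - P t) ** ?M t)" if "s \<in> S" for s
  proof -
    have "?M s ** (P s - P t) ** ?M t = ?M t - ?M s ** (P t ** ?M t)"
      by (simp add: matrix_mult_diff_left matrix_mult_diff_right inv[OF that] matrix_mul_assoc)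
    then show ?thesis by (simp add: inv[OF \<open>t \<in> S\<close>])
  qed
  have near: "\<forall>\<^sub>F s in at t within S. s \<in> S"
    by (simp add: eventually_at_filter)
  have "(P \<longlongrightarrow> P t) (at t within S)"
    using has_vector_derivative_continuous[OF der] by (simp add: continuous_within)
  then have lim0: "((\<lambda>s. c * norm (P s - P t) * norm (?M t)) \<longlongrightarrow> 0) (at t within S)"
    by (intro tendsto_mult_left_zero tendsto_mult_right_zero tendsto_norm_zero LIM_zero)
  have "((\<lambda>s. ?M s - ?M t) \<longlongrightarrow> 0) (at t within S)"
  proof (rule Lim_null_comparison[OF _ lim0], rule eventually_mono[OF near])
    fix s assume "s \<in> S"
    have "norm (?M s ** (P s - P t) ** ?M t) \<le> norm (?M s) * norm (P s - P t) * norm (?M t)"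
      by (rule order_trans[OF norm_matrix_matrix_mult_le])
        (intro mult_right_mono norm_matrix_matrix_mult_le norm_ge_zero)
    also have "\<dots> \<le> c * norm (P s - P t) * norm (?M t)"
      using bounded[OF \<open>s \<in> S\<close>] by (intro mult_right_mono) auto
    finally show "norm (?M s - ?M t) \<le> c * norm (P s - P t) * norm (?M t)"
      using diff[OF \<open>s \<in> S\<close>] by simp
  qed
  then have Mlim: "(?M \<longlongrightarrow> ?M t) (at t within S)"
    by (simp add: LIM_zero_iff)
  have quot: "((\<lambda>s. (P s - P t) /\<^sub>R (s - t)) \<longlongrightarrow> P') (at t within S)"
    using der by (simp add: has_vector_derivative_within_quotient)
  have "((\<lambda>s. - (?M s ** ((P s - P t) /\<^sub>R (s - t)) ** ?M t)) \<longlongrightarrow> - (?M t ** P' ** ?M t))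
      (at t within S)"
    by (intro tendsto_minus bounded_bilinear.tendsto[OF bounded_bilinear_matrix_matrix_mult]
        Mlim quot tendsto_const)
  moreover have "\<forall>\<^sub>F s in at t within S.
      - (?M s ** ((P s - P t) /\<^sub>R (s - t)) ** ?M t) = (?M s - ?M t) /\<^sub>R (s - t)"
    by (rule eventually_mono[OF near])
      (simp add: diff matrix_mult_scaleR_left matrix_mult_scaleR_right)
  ultimately have "((\<lambda>s. (?M s - ?M t) /\<^sub>R (s - t)) \<longlongrightarrow> - (?M t ** P' ** ?M t)) (at t within S)"
    by (rule Lim_transform_eventually)
  then show ?thesis
    by (simp add: has_vector_derivative_within_quotient)
qed

text \<open>The weighted function \<open>exp (k * s) * m s\<close> has derivative at least
  \<open>exp (k * s) * g s \<ge> 0\<close>. Up to time \<delta> its monotonicity preserves the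
  initial value; later the last window of length \<delta> alone contributes \<nu>. The minimum in
  the conclusion covers both cases.\<close>

lemma observability_growth:
  fixes m m' g f :: "real \<Rightarrow> real"
  assumes der: "\<And>s. 0 \<le> s \<Longrightarrow> s \<le> T \<Longrightarrow> (m has_real_derivative m' s) (at s within {0..})"
    and m'_ge: "\<And>s. 0 \<le> s \<Longrightarrow> s \<le> T \<Longrightarrow> g s - k * m s \<le> m' s"
    and g_nonneg: "\<And>s. 0 \<le> s \<Longrightarrow> s \<le> T \<Longrightarrow> 0 \<le> g s"
    and g_ge: "\<And>s. 0 \<le> s \<Longrightarrow> s \<le> T \<Longrightarrow> f s \<le> g s"
    and m_nonneg: "\<And>s. 0 \<le> s \<Longrightarrow> s \<le> T \<Longrightarrow> 0 \<le> m s"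
    and f: "continuous_on {0..} f"
    and observable: "\<And>s. 0 \<le> s \<Longrightarrow> \<nu> \<le> integral {s..s+\<delta>} f"
    and "0 < \<delta>" "0 \<le> k" "0 \<le> \<nu>" "0 \<le> T"
  shows "exp (- k * \<delta>) * min (m 0) \<nu> \<le> m T"
proof -
  have wder: "((\<lambda>s. exp (k * s) * m s) has_real_derivative exp (k * s) * (m' s + k * m s))
      (at s within {0..})" if "0 \<le> s" "s \<le> T" for s
    by (rule derivative_eq_intros der[OF that] refl | simp add: algebra_simps)+
  show ?thesis
  proof (cases "T \<le> \<delta>")
    case True
    have "exp (k * 0) * m 0 \<le> exp (k * T) * m T"
      by (rule DERIV_within_nonneg_mono[OF order_refl \<open>0 \<le> T\<close> wder])
        (use m'_ge g_nonneg in \<open>force+\<close>)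
    then have "exp (- k * T) * m 0 \<le> exp (- k * T) * (exp (k * T) * m T)"
      by simp
    then have "exp (- k * T) * m 0 \<le> m T"
      by (simp flip: mult.assoc exp_add)
    moreover have "exp (- k * \<delta>) * min (m 0) \<nu> \<le> exp (- k * T) * m 0"
      using True \<open>0 \<le> k\<close> \<open>0 \<le> \<nu>\<close> m_nonneg[of 0] \<open>0 \<le> T\<close>
      by (intro mult_mono) (auto simp: mult_left_mono)
    ultimately show ?thesis by simp
  next
    case False
    define u where "u = T - \<delta>"
    have u: "0 \<le> u" "u \<le> T" "T = u + \<delta>" using False \<open>0 < \<delta>\<close> by (auto simp: u_def)
    let ?F = "\<lambda>s. integral {u..s} f"
    have Fder: "(?F has_real_derivative f s) (at s within {u..T})" if "u \<le> s" "s \<le> T" for s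
      unfolding has_real_derivative_iff_has_vector_derivative
      by (rule integral_has_vector_derivative[OF continuous_on_subset[OF f]]) (use that u in auto)
    \<comment> \<open>The mean value theorem compares the growth with the integral of the minorant
      \<open>f\<close>, so that only the continuous \<open>f\<close> is ever integrated. The weight
      is frozen at its least value on the window, at \<open>u\<close>.\<close>
    have "exp (k * u) * m u - exp (k * u) * ?F u \<le> exp (k * T) * m T - exp (k * u) * ?F T"
    proof -
      let ?w = "\<lambda>s. exp (k * s) * m s - exp (k * u) * ?F s"
      let ?w' = "\<lambda>s. exp (k * s) * (m' s + k * m s) - exp (k * u) * f s"
      have "(?w has_derivative (*) (?w' s)) (at s within {u..T})" if "u \<le> s" "s \<le> T" for s
        unfolding has_field_derivative_def[symmetric]
        by (intro DERIV_diff DERIV_cmult Fder that DERIV_subset[OF wder]) (use that u in auto)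
      then obtain s where s: "s \<in> {u..T}" "?w T - ?w u = ?w' s * (T - u)"
        using mvt_very_simple[OF u(2), of ?w "\<lambda>s. (*) (?w' s)"] by blast
      have s0: "0 \<le> s" "s \<le> T" using s(1) u by auto
      have "exp (k * u) * f s \<le> exp (k * u) * g s"
        using g_ge[OF s0] by simp
      also have "\<dots> \<le> exp (k * s) * g s"
        using g_nonneg[OF s0] s(1) \<open>0 \<le> k\<close> by (intro mult_right_mono) (auto simp: mult_left_mono)
      also have "\<dots> \<le> exp (k * s) * (m' s + k * m s)"
        using m'_ge[OF s0] by simp
      finally have "0 \<le> ?w' s * (T - u)"
        using u(2) by simp
      then show ?thesis using s(2) by simp
    qed
    moreover have "?F u = 0" by simp
    ultimately have "exp (k * u) * m u + exp (k * u) * ?F T \<le> exp (k * T) * m T"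
      by simp
    moreover have "exp (k * u) * \<nu> \<le> exp (k * u) * ?F T"
      using observable[OF u(1)] u(3) by simp
    moreover have "0 \<le> exp (k * u) * m u"
      using m_nonneg[OF u(1,2)] by simp
    ultimately have "exp (k * u) * \<nu> \<le> exp (k * T) * m T" by linarith
    then have "exp (- k * T) * (exp (k * u) * \<nu>) \<le> exp (- k * T) * (exp (k * T) * m T)"
      by simp
    then have "exp (- k * \<delta>) * \<nu> \<le> m T"
      by (simp flip: mult.assoc exp_add add: u_def ring_distribs)
    moreover have "exp (- k * \<delta>) * min (m 0) \<nu> \<le> exp (- k * \<delta>) * \<nu>" by simp
    ultimately show ?thesis by linarith
  qed
qed

text \<open>If the bound failed, the level \<open>r\<close> would be attained, and there would be a
  first such time \<open>T\<close>. Up to \<open>T\<close> the weak bound holds, so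
  \<open>step\<close> makes it strict at \<open>T\<close>, a contradiction.\<close>

lemma continuous_bootstrap:
  fixes f :: "real \<Rightarrow> real"
  assumes cont: "continuous_on {0..} f" and "f 0 < r"
    and step: "\<And>T. 0 \<le> T \<Longrightarrow> (\<And>s. 0 \<le> s \<Longrightarrow> s \<le> T \<Longrightarrow> f s \<le> r) \<Longrightarrow> f T < r"
    and "0 \<le> t"
  shows "f t < r"
proof (rule ccontr)
  assume "\<not> f t < r"
  have cont': "continuous_on {0..u} f" for u
    using cont by (rule continuous_on_subset) auto
  define S where "S = {0..t} \<inter> f -` {r}"
  have "\<exists>s\<ge>0. s \<le> t \<and> f s = r"
    using IVT'[of f 0 r t] \<open>f 0 < r\<close> \<open>\<not> f t < r\<close> \<open>0 \<le> t\<close> cont' by simp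
  then have "S \<noteq> {}" by (auto simp: S_def)
  moreover have "closed S"
    unfolding S_def by (rule continuous_closed_preimage[OF cont']) auto
  then have "compact S"
    using compact_Int_closed[of "{0..t}" S] by (simp add: S_def Int_absorb1)
  ultimately obtain T where T: "T \<in> S" and first: "\<And>s. s \<in> S \<Longrightarrow> T \<le> s"
    using compact_attains_inf[of S] by blast
  have "f s \<le> r" if "0 \<le> s" "s \<le> T" for s
  proof (rule ccontr)
    assume "\<not> f s \<le> r"
    then have "\<exists>u\<ge>0. u \<le> s \<and> f u = r"
      using IVT'[of f 0 r s] \<open>f 0 < r\<close> that cont' by simp
    then obtain u where u: "0 \<le> u" "u \<le> s" "f u = r" by blast
    then have "u \<in> S" using that T by (auto simp: S_def)
    then have "s = T" using first u that by force
    then show False using T \<open>\<not> f s \<le> r\<close> by (simp add: S_def)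
  qed
  then have "f T < r" using T by (intro step) (auto simp: S_def)
  then show False using T by (simp add: S_def)
qed

subsection \<open>Attitude kinematics and output errors\<close>

declare transpose_matrix_vector [simp del]

lemma norm_vec_le:
  fixes v :: "real^'m"
  assumes "\<And>k. \<bar>v $ k\<bar> \<le> c"
  shows "norm v \<le> real CARD('m) * c"
proof -
  have "norm v \<le> (\<Sum>k\<in>UNIV. \<bar>v $ k\<bar>)"
    by (rule norm_le_l1_cart)
  also have "\<dots> \<le> (\<Sum>k\<in>(UNIV :: 'm set). c)"
    by (rule sum_mono) (rule assms)
  finally show ?thesis by simp
qed

section \<open>Cross product matrices and skew parts\<close>

lemma cross_mat_eq:
  "cross_mat w = vector [vector [0, - w $ 3, w $ 2], vector [w $ 3, 0, - w $ 1],
    vector [- w $ 2, w $ 1, 0]]"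
  unfolding matrix_eq cross_mat_mult
  by (simp add: vec_eq_iff forall_3 matrix_vector_mult_def sum_3 cross3_def)

lemma cross_mat_nth:
  "cross_mat w $ 1 $ 1 = 0" "cross_mat w $ 1 $ 2 = - w $ 3" "cross_mat w $ 1 $ 3 = w $ 2"
  "cross_mat w $ 2 $ 1 = w $ 3" "cross_mat w $ 2 $ 2 = 0" "cross_mat w $ 2 $ 3 = - w $ 1"
  "cross_mat w $ 3 $ 1 = - w $ 2" "cross_mat w $ 3 $ 2 = w $ 1" "cross_mat w $ 3 $ 3 = 0"
  by (simp_all add: cross_mat_eq)

lemma transpose_cross_mat: "transpose (cross_mat w) = - cross_mat w"
  by (simp add: vec_eq_iff forall_3 transpose_def cross_mat_nth)

lemma norm_cross3_le: "norm (cross3 x y) \<le> norm x * norm y"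
proof -
  have "(norm (cross3 x y))\<^sup>2 \<le> (norm x * norm y)\<^sup>2"
    using norm_cross_dot[of x y] by (metis le_add_same_cancel1 zero_le_power2)
  then show ?thesis by (rule power2_le_imp_le) simp
qed

lemma norm_cross_mat_le: "norm (cross_mat w) \<le> 2 * norm w"
proof -
  have "cross_mat w \<bullet> cross_mat w = 2 * (w \<bullet> w)"
    by (simp add: inner_vec_def sum_3 cross_mat_nth)
  then have "(norm (cross_mat w))\<^sup>2 \<le> (2 * norm w)\<^sup>2"
    by (simp add: power_mult_distrib flip: dot_square_norm)
  then show ?thesis by (rule power2_le_imp_le) simp
qed

text \<open>The inverse of \<open>cross_mat\<close>, applied to the skew part of \<open>A\<close>.
  For a rotation by an angle \<theta> about a unit axis it is the axis times sin \<theta>.\<close>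

definition skew_vec :: "real^3^3 \<Rightarrow> real^3" where
  "skew_vec A = (1/2) *\<^sub>R vector [A $ 3 $ 2 - A $ 2 $ 3, A $ 1 $ 3 - A $ 3 $ 1, A $ 2 $ 1 - A $ 1 $ 2]"

lemma cross_mat_skew_vec: "cross_mat (skew_vec A) = (1/2) *\<^sub>R (A - transpose A)"
  by (simp add: vec_eq_iff forall_3 transpose_def cross_mat_nth skew_vec_def field_simps)

lemma skew_vec_diff_mat_1: "skew_vec (A - mat 1) = skew_vec A"
  by (simp add: skew_vec_def mat_def)

lemma norm_skew_vec_le: "norm (skew_vec A) \<le> norm A"
proof -
  have sq: "((x - y) / 2)\<^sup>2 \<le> x\<^sup>2 + y\<^sup>2" for x y :: real
  proof -
    have "((x - y) / 2)\<^sup>2 + ((x + y) / 2)\<^sup>2 = (x\<^sup>2 + y\<^sup>2) / 2"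
      by (simp add: power2_eq_square field_simps)
    then have "((x - y) / 2)\<^sup>2 \<le> (x\<^sup>2 + y\<^sup>2) / 2"
      by (metis le_add_same_cancel1 zero_le_power2)
    also have "\<dots> \<le> x\<^sup>2 + y\<^sup>2" by simp
    finally show ?thesis .
  qed
  have "skew_vec A \<bullet> skew_vec A =
      ((A $ 3 $ 2 - A $ 2 $ 3) / 2)\<^sup>2 + ((A $ 1 $ 3 - A $ 3 $ 1) / 2)\<^sup>2 + ((A $ 2 $ 1 - A $ 1 $ 2) / 2)\<^sup>2"
    by (simp add: inner_vec_def sum_3 skew_vec_def power2_eq_square)
  also have "\<dots> \<le> ((A $ 3 $ 2)\<^sup>2 + (A $ 2 $ 3)\<^sup>2) + ((A $ 1 $ 3)\<^sup>2 + (A $ 3 $ 1)\<^sup>2)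
      + ((A $ 2 $ 1)\<^sup>2 + (A $ 1 $ 2)\<^sup>2)"
    by (intro add_mono sq)
  also have "\<dots> \<le> A \<bullet> A"
    by (simp add: inner_vec_def sum_3 power2_eq_square)
  finally have "(norm (skew_vec A))\<^sup>2 \<le> (norm A)\<^sup>2"
    by (simp add: dot_square_norm)
  then show ?thesis by (rule power2_le_imp_le) simp
qed

lemma bounded_linear_skew_vec: "bounded_linear skew_vec"
  by (rule bounded_linear_intro[where K = 1])
    (simp_all add: norm_skew_vec_le, simp_all add: skew_vec_def vec_eq_iff forall_3 field_simps)

text \<open>At \<open>A = mat 1\<close> the right-hand side is \<open>w\<close>. Hence near the
  identity the skew vector of a rotation moves with its angular velocity, up to an error
  proportional to the distance from the identity.\<close>

lemma skew_vec_cross_mat_mult: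
  "skew_vec (cross_mat w ** A) = (1/2) *\<^sub>R (trace A *\<^sub>R w - A *v w)"
  by (simp add: vec_eq_iff forall_3 skew_vec_def matrix_matrix_mult_def matrix_vector_mult_def sum_3
      cross_mat_nth trace_def field_simps)

lemma abs_trace_le: "\<bar>trace A\<bar> \<le> 3 * norm A" for A :: "real^3^3"
proof -
  have "\<bar>A $ i $ i\<bar> \<le> norm A" for i
    using component_le_norm_cart[of "A $ i" i] Finite_Cartesian_Product.norm_nth_le[of A i] by (rule order_trans)
  from this[of 1] this[of 2] this[of 3] show ?thesis
    by (simp add: trace_def sum_3)
qed

lemma orthogonal_matrix_norm:
  fixes X :: "real^'n^'n"
  assumes "orthogonal_matrix X"
  shows "norm (X *v x) = norm x" "norm (transpose X *v x) = norm x"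
proof -
  have *: "norm (Y *v x) = norm x" if "orthogonal_matrix Y" for Y :: "real^'n^'n"
    using that by (simp add: norm_eq_sqrt_inner inner_matrix_transpose matrix_vector_mul_assoc
        orthogonal_matrix_def)
  show "norm (X *v x) = norm x" "norm (transpose X *v x) = norm x"
    using *[of X] *[of "transpose X"] assms by simp_all
qed

text \<open>For orthogonal \<open>E\<close> the product of \<open>E - mat 1\<close> with its
  transpose expands to twice the identity minus \<open>E\<close> minus its transpose. So the
  symmetric part of \<open>E - mat 1\<close> is of second order, and the skew part carries the whole
  first-order error.\<close>

lemma orthogonal_minus_mat_1:
  fixes E :: "real^3^3"
  assumes "orthogonal_matrix E"
  shows "E - mat 1 = cross_mat (skew_vec E) - (1/2) *\<^sub>R ((E - mat 1) ** transpose (E - mat 1))"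
proof -
  have "transpose (E - mat 1) = transpose E - mat 1"
    by (simp add: vec_eq_iff transpose_def mat_def)
  then have "(E - mat 1) ** transpose (E - mat 1) = mat 1 + mat 1 - E - transpose E"
    using assms by (simp add: matrix_mult_diff_left matrix_mult_diff_right orthogonal_matrix_def)
  then have "(1/2) *\<^sub>R ((E - mat 1) ** transpose (E - mat 1))
      = (1/2) *\<^sub>R (mat 1 + mat 1) - (1/2) *\<^sub>R (E + transpose E)"
    by (simp only: scaleR_diff_right scaleR_add_right) simp
  then show ?thesis
    by (simp add: cross_mat_skew_vec vec_eq_iff field_simps)
qed

text \<open>With \<open>?d \<le> 1\<close> the quadratic term is at most half of \<open>?d\<close>
  and can be absorbed. Some such restriction is unavoidable, as half-turns have skew vector
  0.\<close>

lemma norm_orthogonal_minus_mat_1_le: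
  fixes E :: "real^3^3"
  assumes "orthogonal_matrix E" and "norm (E - mat 1) \<le> 1"
  shows "norm (E - mat 1) \<le> 4 * norm (skew_vec E)"
proof -
  let ?d = "norm (E - mat 1)"
  have "norm ((E - mat 1) ** transpose (E - mat 1)) \<le> ?d * ?d"
    using norm_matrix_matrix_mult_le[of "E - mat 1" "transpose (E - mat 1)"]
    by (simp add: norm_transpose)
  moreover have "?d \<le> norm (cross_mat (skew_vec E))
      + norm ((1/2) *\<^sub>R ((E - mat 1) ** transpose (E - mat 1)))"
    by (subst orthogonal_minus_mat_1[OF assms(1)]) (rule norm_triangle_ineq4)
  moreover have "?d * ?d \<le> ?d * 1"
    using assms(2) by (intro mult_left_mono) auto
  ultimately show ?thesis
    using norm_cross_mat_le[of "skew_vec E"] by simp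
qed

text \<open>The Gram matrix of \<open>E\<close> is constant because \<open>cross_mat\<close> is
  skew.\<close>

lemma rotation_kinematics_orthogonal:
  assumes der: "\<And>t. 0 \<le> t \<Longrightarrow> (E has_vector_derivative cross_mat (w t) ** E t) (at t within {0..})"
    and "orthogonal_matrix (E 0)" and "0 \<le> t"
  shows "orthogonal_matrix (E t)"
proof -
  have "((\<lambda>t. transpose (E t) ** E t) has_vector_derivative 0) (at t within {0..})" if "0 \<le> t" for t
  proof -
    have "((\<lambda>t. transpose (E t)) has_vector_derivative transpose (cross_mat (w t) ** E t))
        (at t within {0..})"
      by (rule bounded_linear.has_vector_derivative[OF bounded_linear_transpose der[OF that]])
    from has_vector_derivative_matrix_mult[OF this der[OF that]] show ?thesis
      by (simp add: matrix_transpose_mul transpose_cross_mat matrix_mult_minus_left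
          matrix_mult_minus_right matrix_mul_assoc)
  qed
  then obtain S where S: "\<And>t. t \<in> {0..} \<Longrightarrow> transpose (E t) ** E t = S"
    using has_vector_derivative_zero_constant[of "{0::real..}" "\<lambda>t. transpose (E t) ** E t"]
    by auto
  then have "transpose (E t) ** E t = mat 1"
    using S[of 0] assms(2,3) by (simp add: orthogonal_matrix_def)
  then show ?thesis
    by (simp add: orthogonal_matrix)
qed

section \<open>Output stacks and their dependence on the attitude error\<close>

lemma C_stack_mult_nth:
  "(C_stack idx a b X *v x) $ k =
    a (fst (idx k)) (snd (idx k)) \<bullet> (transpose X *v cross3 (b (fst (idx k))) x)"
  unfolding matrix_vector_mul_component
  by (simp add: C_stack_def case_prod_beta dot_lmul_matrix
      flip: cross_mat_mult matrix_vector_mul_assoc)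

context
  fixes idx :: "'m::finite \<Rightarrow> nat \<times> nat" and a :: "nat \<Rightarrow> nat \<Rightarrow> real^3" and b :: "nat \<Rightarrow> real^3"
    and B :: real
  assumes a_le: "\<And>k. norm (a (fst (idx k)) (snd (idx k))) \<le> B"
    and b_le: "\<And>k. norm (b (fst (idx k))) \<le> B"
begin

lemma B_nonneg: "0 \<le> B"
  using norm_ge_zero a_le by (rule order_trans)

text \<open>The output matrix, its change with the attitude, the output error and its linearization
  error all have rows of this shape, so each bound reduces to one on the vectors
  \<open>z k\<close>.\<close>

lemma norm_stack_le:
  fixes y :: "real^'m"
  assumes y: "\<And>k. y $ k = a (fst (idx k)) (snd (idx k)) \<bullet> z k"
    and z: "\<And>k. norm (z k) \<le> B * c"
  shows "norm y \<le> real CARD('m) * B\<^sup>2 * c"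
proof -
  have "\<bar>y $ k\<bar> \<le> B * (B * c)" for k
  proof -
    have "\<bar>y $ k\<bar> \<le> norm (a (fst (idx k)) (snd (idx k))) * norm (z k)"
      by (simp add: y Cauchy_Schwarz_ineq2)
    also have "\<dots> \<le> B * (B * c)"
      by (intro mult_mono a_le z B_nonneg norm_ge_zero)
    finally show ?thesis .
  qed
  from norm_vec_le[OF this] show ?thesis
    by (simp add: power2_eq_square mult.assoc)
qed

lemma norm_C_stack_le:
  assumes "orthogonal_matrix X"
  shows "norm (C_stack idx a b X *v x) \<le> real CARD('m) * B\<^sup>2 * norm x"
proof (rule norm_stack_le[OF C_stack_mult_nth])
  fix k
  have "norm (cross3 (b (fst (idx k))) x) \<le> norm (b (fst (idx k))) * norm x"
    by (rule norm_cross3_le)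
  also have "\<dots> \<le> B * norm x"
    by (intro mult_right_mono b_le norm_ge_zero)
  finally show "norm (transpose X *v cross3 (b (fst (idx k))) x) \<le> B * norm x"
    by (simp add: orthogonal_matrix_norm[OF assms])
qed

context
  fixes X R :: "real^3^3"
  assumes X: "orthogonal_matrix X" and R: "orthogonal_matrix R"
begin

text \<open>Factoring out the orthogonal \<open>transpose R\<close> makes differences between
  estimate and truth depend on the attitude error alone.\<close>

lemma transpose_diff_mult:
  "transpose X *v z - transpose R *v z = transpose R *v (transpose (X ** transpose R - mat 1) *v z)"
proof -
  have "transpose (X ** transpose R - mat 1) = R ** transpose X - mat 1"
    by (simp add: vec_eq_iff transpose_def mat_def matrix_matrix_mult_def mult.commute)
  then have "transpose R ** transpose (X ** transpose R - mat 1) = transpose X - transpose R"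
    using R by (simp add: matrix_mult_diff_right matrix_mul_assoc orthogonal_matrix_def)
  then show ?thesis
    by (simp add: matrix_vector_mul_assoc matrix_vector_mult_diff_rdistrib)
qed

lemma norm_transpose_diff_mult_le:
  "norm (transpose X *v z - transpose R *v z) \<le> norm (X ** transpose R - mat 1) * norm z"
  using norm_matrix_vector_mult_le[of "transpose (X ** transpose R - mat 1)" z]
  by (simp add: transpose_diff_mult orthogonal_matrix_norm[OF R] norm_transpose)

lemma norm_C_stack_diff_le:
  "norm (C_stack idx a b X *v x - C_stack idx a b R *v x)
    \<le> real CARD('m) * B\<^sup>2 * (norm (X ** transpose R - mat 1) * norm x)"
proof (rule norm_stack_le)
  fix k
  let ?z = "cross3 (b (fst (idx k))) x"
  show "(C_stack idx a b X *v x - C_stack idx a b R *v x) $ k =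
      a (fst (idx k)) (snd (idx k)) \<bullet> (transpose X *v ?z - transpose R *v ?z)"
    by (simp add: C_stack_mult_nth inner_diff_right)
  have "norm ?z \<le> norm (b (fst (idx k))) * norm x"
    by (rule norm_cross3_le)
  also have "\<dots> \<le> B * norm x"
    by (intro mult_right_mono b_le norm_ge_zero)
  finally have "norm (X ** transpose R - mat 1) * norm ?z
      \<le> norm (X ** transpose R - mat 1) * (B * norm x)"
    by (intro mult_left_mono) auto
  with norm_transpose_diff_mult_le[of ?z]
  show "norm (transpose X *v ?z - transpose R *v ?z)
      \<le> B * (norm (X ** transpose R - mat 1) * norm x)"
    by (simp add: mult_ac)
qed

lemma norm_output_error_le:
  "norm (output_stack idx a b X - output_stack idx a b R)
    \<le> real CARD('m) * B\<^sup>2 * norm (X ** transpose R - mat 1)"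
proof (rule norm_stack_le)
  fix k
  let ?z = "b (fst (idx k))"
  show "(output_stack idx a b X - output_stack idx a b R) $ k =
      a (fst (idx k)) (snd (idx k)) \<bullet> (transpose X *v ?z - transpose R *v ?z)"
    by (simp add: output_stack_def case_prod_beta inner_diff_right)
  have "norm (X ** transpose R - mat 1) * norm ?z \<le> norm (X ** transpose R - mat 1) * B"
    by (intro mult_left_mono b_le norm_ge_zero)
  with norm_transpose_diff_mult_le[of ?z]
  show "norm (transpose X *v ?z - transpose R *v ?z) \<le> B * norm (X ** transpose R - mat 1)"
    by (simp add: mult_ac)
qed

text \<open>Each row of the output error applies \<open>transpose X\<close> to
  \<open>?z - ?E *v ?z\<close>. Splitting \<open>?E - mat 1\<close> into skew part and quadratic
  remainder, the skew part yields exactly the row of \<open>C_stack\<close> applied to the skew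
  vector, once the cross product is reversed; only the remainder is left.\<close>

lemma output_error_linearization:
  "norm (output_stack idx a b X - output_stack idx a b R
      - C_stack idx a b X *v skew_vec (X ** transpose R))
    \<le> real CARD('m) * B\<^sup>2 * ((norm (X ** transpose R - mat 1))\<^sup>2 / 2)"
proof (rule norm_stack_le)
  fix k
  let ?E = "X ** transpose R"
  let ?D = "?E - mat 1"
  let ?z = "b (fst (idx k))"
  let ?rem = "(1/2) *\<^sub>R (?D *v (transpose ?D *v ?z))"
  have E: "orthogonal_matrix ?E"
    using X R by (simp add: orthogonal_matrix_mul)
  have "?D *v ?z = (cross_mat (skew_vec ?E) - (1/2) *\<^sub>R (?D ** transpose ?D)) *v ?z"
    using orthogonal_minus_mat_1[OF E] by (rule arg_cong)
  also have "\<dots> = cross3 (skew_vec ?E) ?z - ?rem"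
    by (simp only: matrix_vector_mult_diff_rdistrib cross_mat_mult matrix_vector_mul_assoc
        scaleR_matrix_vector_assoc)
  finally have "?D *v ?z = cross3 (skew_vec ?E) ?z - ?rem" .
  then have "?z - ?E *v ?z = cross3 ?z (skew_vec ?E) + ?rem"
    by (simp add: matrix_vector_mult_diff_rdistrib cross_skew[of ?z] algebra_simps)
  moreover have "transpose X *v (?E *v ?z) = transpose R *v ?z"
    using X by (simp add: matrix_vector_mul_assoc matrix_mul_assoc orthogonal_matrix_def)
  ultimately have "transpose X *v ?z - transpose R *v ?z
      = transpose X *v cross3 ?z (skew_vec ?E) + transpose X *v ?rem"
    by (metis matrix_vector_mult_diff_distrib matrix_vector_right_distrib)
  then show "(output_stack idx a b X - output_stack idx a b R
      - C_stack idx a b X *v skew_vec ?E) $ k = a (fst (idx k)) (snd (idx k)) \<bullet> (transpose X *v ?rem)"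
    by (simp add: output_stack_def case_prod_beta C_stack_mult_nth flip: inner_diff_right)
  have "norm (?D *v (transpose ?D *v ?z)) \<le> norm ?D * norm (transpose ?D *v ?z)"
    by (rule norm_matrix_vector_mult_le)
  also have "\<dots> \<le> norm ?D * (norm ?D * norm ?z)"
    using norm_matrix_vector_mult_le[of "transpose ?D" ?z]
    by (intro mult_left_mono) (simp_all add: norm_transpose)
  also have "\<dots> \<le> norm ?D * (norm ?D * B)"
    by (intro mult_left_mono b_le) auto
  finally show "norm (transpose X *v ?rem) \<le> B * ((norm ?D)\<^sup>2 / 2)"
    by (simp only: orthogonal_matrix_norm[OF X]) (simp add: power2_eq_square mult_ac)
qed

end

end

subsection \<open>Bounds on the Riccati solution\<close>

text \<open>The hypotheses in quantitative form. The output matrix is taken at the true attitude,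
  and the integral in \<open>observable\<close> is not divided by the window length, so \<mu> here
  absorbs a factor \<delta>.\<close>

locale observer_data =
  fixes idx :: "'m::finite \<Rightarrow> nat \<times> nat"
    and a :: "nat \<Rightarrow> nat \<Rightarrow> real \<Rightarrow> real^3" and b :: "nat \<Rightarrow> real \<Rightarrow> real^3"
    and \<Omega> :: "real \<Rightarrow> real^3" and R :: "real \<Rightarrow> real^3^3"
    and Q :: "real \<Rightarrow> real^'m^'m" and V :: "real \<Rightarrow> real^3^3" and P\<^sub>0 :: "real^3^3"
    and B q\<^sub>0 q\<^sub>1 v\<^sub>0 v\<^sub>1 p\<^sub>0 p\<^sub>1 \<delta> \<mu> :: real
  assumes attitude: "attitude_system \<Omega> R"
    and a_le: "\<And>t k. 0 \<le> t \<Longrightarrow> norm (a (fst (idx k)) (snd (idx k)) t) \<le> B"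
    and b_le: "\<And>t k. 0 \<le> t \<Longrightarrow> norm (b (fst (idx k)) t) \<le> B"
    and Q_sym: "\<And>t. 0 \<le> t \<Longrightarrow> transpose (Q t) = Q t"
    and Q_ge: "\<And>t y. 0 \<le> t \<Longrightarrow> q\<^sub>0 * (norm y)\<^sup>2 \<le> y \<bullet> (Q t *v y)"
    and Q_le: "\<And>t y. 0 \<le> t \<Longrightarrow> norm (Q t *v y) \<le> q\<^sub>1 * norm y"
    and V_sym: "\<And>t. 0 \<le> t \<Longrightarrow> transpose (V t) = V t"
    and V_ge: "\<And>t x. 0 \<le> t \<Longrightarrow> v\<^sub>0 * (x \<bullet> x) \<le> x \<bullet> (V t *v x)"
    and V_le: "\<And>t x. 0 \<le> t \<Longrightarrow> x \<bullet> (V t *v x) \<le> v\<^sub>1 * (x \<bullet> x)"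
    and P\<^sub>0_sym: "transpose P\<^sub>0 = P\<^sub>0"
    and P\<^sub>0_ge: "\<And>x. p\<^sub>0 * (x \<bullet> x) \<le> x \<bullet> (P\<^sub>0 *v x)"
    and P\<^sub>0_le: "\<And>x. norm (P\<^sub>0 *v x) \<le> p\<^sub>1 * norm x"
    and continuous_output: "\<And>x. continuous_on {0..}
      (\<lambda>s. (norm (C_stack idx (\<lambda>i j. a i j s) (\<lambda>i. b i s) (R s) *v x))\<^sup>2)"
    and observable: "\<And>t x. 0 \<le> t \<Longrightarrow> \<mu> * (norm x)\<^sup>2 \<le> integral {t..t + \<delta>}
      (\<lambda>s. (norm (C_stack idx (\<lambda>i j. a i j s) (\<lambda>i. b i s) (R s) *v x))\<^sup>2)"
    and pos: "0 < B" "0 < q\<^sub>0" "0 < q\<^sub>1" "0 < v\<^sub>0" "0 < v\<^sub>1" "0 < p\<^sub>0" "0 < p\<^sub>1" "0 < \<delta>" "0 < \<mu>"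
begin

text \<open>These constants depend on the data only, hence are uniform over all trajectories.\<close>

definition "c = real CARD('m) * B\<^sup>2"

text \<open>The last entry makes \<open>P_min\<^sup>2 * (q\<^sub>1 * c\<^sup>2)\<close> less than
  \<open>v\<^sub>0\<close>, so that the lower bound is a barrier for the Riccati flow; halving
  \<open>p\<^sub>0\<close> gives strictness at time 0.\<close>

definition "P_min = min (p\<^sub>0 / 2) (min 1 (v\<^sub>0 / (2 * (q\<^sub>1 * c\<^sup>2))))"

text \<open>The exponent is the largest possible relative loss of \<open>M\<close> over one window.
  The minimum combines a lower bound for the inverse of \<open>P\<^sub>0\<close> with the
  information gained in a window when the estimate is close to the truth.\<close>

definition "M_min = exp (- (v\<^sub>1 / P_min) * \<delta>) * min (p\<^sub>0 / p\<^sub>1\<^sup>2) (q\<^sub>0 * \<mu> / 4)"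

text \<open>Along trajectories within \<open>radius\<close>, the higher-order terms in the
  derivative of the Lyapunov function are at most
  \<open>K * radius * (norm (lam t))\<^sup>2\<close>.\<close>

definition "K = 4 * (c\<^sup>2 * q\<^sub>1) + 16 * (c\<^sup>2 * q\<^sub>1) / (P_min * M_min)"

text \<open>The three entries serve, in order, the comparison of the error with its skew vector, the
  observability of the perturbed output matrix, and the absorption of higher-order terms into half
  of the damping.\<close>

definition "radius = min 1 (min (\<mu> / (4 * \<delta> * c\<^sup>2)) (v\<^sub>0 * M_min\<^sup>2 / (2 * K)))"

lemma c_pos: "0 < c"
  using pos by (simp add: c_def)

lemma P_min_pos: "0 < P_min"
  using pos c_pos by (simp add: P_min_def)

lemma M_min_pos: "0 < M_min"
  using pos by (simp add: M_min_def)

lemma K_pos: "0 < K"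
  using pos c_pos P_min_pos M_min_pos by (auto simp: K_def intro!: add_pos_pos divide_pos_pos mult_pos_pos)

lemma radius_pos: "0 < radius"
  using pos c_pos M_min_pos K_pos by (simp add: radius_def)

lemma radius_le:
  "radius \<le> 1" "\<delta> * (c\<^sup>2 * radius\<^sup>2) \<le> \<mu> / 4" "K * radius \<le> v\<^sub>0 * M_min\<^sup>2 / 2"
proof -
  show le1: "radius \<le> 1" by (simp add: radius_def)
  have "radius\<^sup>2 \<le> radius * 1"
    unfolding power2_eq_square using le1 radius_pos by (intro mult_left_mono) auto
  also have "\<dots> \<le> \<mu> / (4 * \<delta> * c\<^sup>2)"
    by (simp add: radius_def)
  finally show "\<delta> * (c\<^sup>2 * radius\<^sup>2) \<le> \<mu> / 4"
    using pos c_pos by (simp add: field_simps)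
  have "radius \<le> v\<^sub>0 * M_min\<^sup>2 / (2 * K)"
    by (simp add: radius_def)
  then show "K * radius \<le> v\<^sub>0 * M_min\<^sup>2 / 2"
    using K_pos by (simp add: field_simps)
qed

end

locale observer_trajectory = observer_data +
  fixes Rh P :: "real \<Rightarrow> real^3^3"
  assumes trajectory: "riccati_observer idx \<Omega> a b Q V P\<^sub>0 R Rh P"
begin

section \<open>Signals along one trajectory\<close>

definition "E t = Rh t ** transpose (R t)"

definition "C t = C_stack idx (\<lambda>i j. a i j t) (\<lambda>i. b i t) (Rh t)"

definition "G t = transpose (C t) ** Q t ** C t"

definition "y t = output_stack idx (\<lambda>i j. a i j t) (\<lambda>i. b i t) (Rh t)
  - output_stack idx (\<lambda>i j. a i j t) (\<lambda>i. b i t) (R t)"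

definition "\<Delta> t = - (P t *v (transpose (C t) *v (Q t *v y t)))"

definition "M t = matrix_inv (P t)"

definition "\<eta> t = norm (E t - mat 1)"

definition "lam t = skew_vec (E t)"

lemma innovation_eq:
  "innovation idx (\<lambda>i j. a i j t) (\<lambda>i. b i t) (Q t) (P t) (R t) (Rh t) = \<Delta> t"
  by (simp add: innovation_def \<Delta>_def C_def y_def flip: matrix_vector_mul_assoc)

lemma R_orthogonal: "0 \<le> t \<Longrightarrow> orthogonal_matrix (R t)"
  using attitude by (simp add: attitude_system_def rotation_matrix_def)

text \<open>The terms with \<Omega> cancel, since estimate and truth are driven by the same angular
  velocity from the right.\<close>

lemma E_der: "(E has_vector_derivative cross_mat (\<Delta> t) ** E t) (at t within {0..})" if "0 \<le> t"
proof -
  have Rh: "(Rh has_vector_derivative Rh t ** cross_mat (\<Omega> t) + cross_mat (\<Delta> t) ** Rh t) (at t within {0..})"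
    using trajectory that by (simp add: riccati_observer_def Let_def innovation_eq)
  have "(R has_vector_derivative R t ** cross_mat (\<Omega> t)) (at t within {0..})"
    using attitude that by (simp add: attitude_system_def)
  then have "((\<lambda>t. transpose (R t)) has_vector_derivative transpose (R t ** cross_mat (\<Omega> t)))
      (at t within {0..})"
    by (rule bounded_linear.has_vector_derivative[OF bounded_linear_transpose])
  from has_vector_derivative_matrix_mult[OF Rh this]
  have "((\<lambda>t. Rh t ** transpose (R t)) has_vector_derivative
      Rh t ** transpose (R t ** cross_mat (\<Omega> t))
        + (Rh t ** cross_mat (\<Omega> t) + cross_mat (\<Delta> t) ** Rh t) ** transpose (R t)) (at t within {0..})" .
  moreover have "Rh t ** transpose (R t ** cross_mat (\<Omega> t))
        + (Rh t ** cross_mat (\<Omega> t) + cross_mat (\<Delta> t) ** Rh t) ** transpose (R t)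
      = cross_mat (\<Delta> t) ** (Rh t ** transpose (R t))"
    by (simp add: matrix_transpose_mul transpose_cross_mat matrix_mult_minus_left
        matrix_mult_minus_right matrix_mul_assoc
        matrix_mult_add_left)
  ultimately show ?thesis
    by (simp add: E_def[abs_def])
qed

lemma E_orthogonal: "orthogonal_matrix (E t)" if "0 \<le> t"
proof (rule rotation_kinematics_orthogonal[OF E_der _ that])
  show "orthogonal_matrix (E 0)"
    using trajectory R_orthogonal[of 0]
    by (simp add: E_def riccati_observer_def rotation_matrix_def orthogonal_matrix_mul)
qed

text \<open>The observer prescribes a rotation at time 0 only; at later times orthogonality is
  inherited from \<open>E\<close> and \<open>R\<close>.\<close>

lemma Rh_orthogonal: "orthogonal_matrix (Rh t)" if "0 \<le> t"
proof -
  have "Rh t = E t ** R t"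
    using R_orthogonal[OF that] by (simp add: E_def orthogonal_matrix_def flip: matrix_mul_assoc)
  then show ?thesis
    using E_orthogonal[OF that] R_orthogonal[OF that] by (simp add: orthogonal_matrix_mul)
qed

lemma norm_C_le: "0 \<le> t \<Longrightarrow> norm (C t *v x) \<le> c * norm x"
  unfolding C_def c_def
  by (rule norm_C_stack_le[where a = "\<lambda>i j. a i j t"]) (simp_all add: a_le b_le Rh_orthogonal)

lemma norm_C_diff_le:
  "0 \<le> t \<Longrightarrow> norm (C t *v x - C_stack idx (\<lambda>i j. a i j t) (\<lambda>i. b i t) (R t) *v x) \<le> c * (\<eta> t * norm x)"
  unfolding C_def c_def \<eta>_def E_def
  by (rule norm_C_stack_diff_le[where a = "\<lambda>i j. a i j t"])
    (simp_all add: a_le b_le Rh_orthogonal R_orthogonal)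

lemma norm_y_le: "0 \<le> t \<Longrightarrow> norm (y t) \<le> c * \<eta> t"
  unfolding y_def c_def \<eta>_def E_def
  by (rule norm_output_error_le[where a = "\<lambda>i j. a i j t"])
    (simp_all add: a_le b_le Rh_orthogonal R_orthogonal)

lemma y_linearization: "0 \<le> t \<Longrightarrow> norm (y t - C t *v lam t) \<le> c * ((\<eta> t)\<^sup>2 / 2)"
  unfolding y_def C_def lam_def c_def \<eta>_def E_def
  by (rule output_error_linearization[where a = "\<lambda>i j. a i j t"])
    (simp_all add: a_le b_le Rh_orthogonal R_orthogonal)

lemma G_form: "x \<bullet> (G t *v z) = (C t *v x) \<bullet> (Q t *v (C t *v z))"
  by (simp add: G_def inner_matrix_transpose flip: matrix_vector_mul_assoc)

lemma norm_G_mult_le: "norm (G t *v x) \<le> q\<^sub>1 * c\<^sup>2 * norm x" if "0 \<le> t"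
proof -
  have "norm (G t *v x) = norm (transpose (C t) *v (Q t *v (C t *v x)))"
    by (simp add: G_def flip: matrix_vector_mul_assoc)
  also have "\<dots> \<le> c * norm (Q t *v (C t *v x))"
    by (rule norm_transpose_mult_le) (rule norm_C_le[OF that])
  also have "\<dots> \<le> c * (q\<^sub>1 * norm (C t *v x))"
    using c_pos by (intro mult_left_mono Q_le that) simp
  also have "\<dots> \<le> c * (q\<^sub>1 * (c * norm x))"
    using c_pos pos by (intro mult_left_mono norm_C_le that) simp_all
  finally show ?thesis by (simp add: power2_eq_square mult_ac)
qed

lemma G_ge: "0 \<le> t \<Longrightarrow> q\<^sub>0 * (norm (C t *v x))\<^sup>2 \<le> x \<bullet> (G t *v x)"
  by (simp add: G_form Q_ge)

lemma P_der: "(P has_vector_derivative - (P t ** G t ** P t) + V t) (at t within {0..})" if "0 \<le> t"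
  using trajectory that by (simp add: riccati_observer_def Let_def G_def C_def matrix_mul_assoc)

lemma P_0: "P 0 = P\<^sub>0"
  using trajectory by (simp add: riccati_observer_def)

lemma P_sym: "transpose (P t) = P t" if "0 \<le> t"
proof (rule riccati_symmetric[OF P_der _ V_sym _ _ that])
  show "transpose (G s) = G s" if "0 \<le> s" for s
    using Q_sym[OF that] by (simp add: G_def matrix_transpose_mul matrix_mul_assoc)
  show "transpose (P 0) = P 0"
    by (simp add: P_0 P\<^sub>0_sym)
  show "norm (G s) \<le> real CARD(3) * (q\<^sub>1 * c\<^sup>2)" if "0 \<le> s" for s
    by (rule norm_matrix_le) (rule norm_G_mult_le[OF that])
qed

lemma P_ge: "P_min * (x \<bullet> x) \<le> x \<bullet> (P t *v x)" if "0 \<le> t"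
proof (rule riccati_lower_bound[OF P_der P_sym _ V_ge _ _ that])
  show "z \<bullet> (G s *v z) \<le> q\<^sub>1 * c\<^sup>2 * (z \<bullet> z)" if "0 \<le> s" for s z
  proof -
    have "z \<bullet> (G s *v z) \<le> norm z * norm (G s *v z)"
      by (rule norm_cauchy_schwarz)
    also have "\<dots> \<le> norm z * (q\<^sub>1 * c\<^sup>2 * norm z)"
      by (intro mult_left_mono norm_G_mult_le that norm_ge_zero)
    finally show ?thesis by (simp add: dot_square_norm power2_eq_square mult_ac)
  qed
  show "P_min < z \<bullet> (P 0 *v z)" if "norm z = 1" for z
  proof -
    have "P_min \<le> p\<^sub>0 / 2" by (simp add: P_min_def)
    also have "\<dots> < p\<^sub>0" using pos by simp
    also have "\<dots> \<le> z \<bullet> (P 0 *v z)"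
      using P\<^sub>0_ge[of z] that by (simp add: P_0 dot_square_norm)
    finally show ?thesis .
  qed
  \<comment> \<open>Since \<open>P_min \<le> 1\<close>, the square is bounded by
    \<open>P_min\<close> itself, to which the last entry of the minimum applies.\<close>
  have "P_min\<^sup>2 \<le> 1 * P_min"
    unfolding power2_eq_square using P_min_pos by (intro mult_right_mono) (auto simp: P_min_def)
  also have "\<dots> \<le> v\<^sub>0 / (2 * (q\<^sub>1 * c\<^sup>2))"
    by (simp add: P_min_def)
  finally have "P_min\<^sup>2 * (q\<^sub>1 * c\<^sup>2) \<le> v\<^sub>0 / 2"
    using pos c_pos by (simp add: field_simps)
  then show "P_min\<^sup>2 * (q\<^sub>1 * c\<^sup>2) < v\<^sub>0"
    using pos by linarith
qed

lemma
  assumes "0 \<le> t"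
  shows P_M: "P t ** M t = mat 1" and M_P: "M t ** P t = mat 1"
    and M_sym: "transpose (M t) = M t"
    and M_quad: "P_min * (norm (M t *v x))\<^sup>2 \<le> x \<bullet> (M t *v x)"
    and norm_M_mult_le: "norm (M t *v x) \<le> norm x / P_min"
    and norm_M_le: "norm (M t) \<le> real CARD(3) / P_min"
  unfolding M_def
  by (fact pos_def_matrix_inv[OF P_sym[OF assms] P_min_pos P_ge[OF assms]])+

text \<open>Passing to the inverse frees \<open>G\<close> from its factors \<open>P\<close>: it
  becomes an additive source of information, and \<open>V\<close> acts as the loss term.\<close>

lemma M_der: "(M has_vector_derivative G t - M t ** V t ** M t) (at t within {0..})" if "0 \<le> t"
proof -
  have "((\<lambda>s. matrix_inv (P s)) has_vector_derivative
      - (matrix_inv (P t) ** (- (P t ** G t ** P t) + V t) ** matrix_inv (P t))) (at t within {0..})"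
    by (rule has_vector_derivative_matrix_inv[OF P_der[OF that], where c = "real CARD(3) / P_min"])
      (use that P_M M_P norm_M_le in \<open>simp_all add: M_def\<close>)
  moreover have "M t ** (- (P t ** G t ** P t) + V t) ** M t
      = - ((M t ** P t) ** G t ** (P t ** M t)) + M t ** V t ** M t"
    by (simp only: matrix_mult_add_left
        matrix_mult_add_right
        matrix_mult_minus_left matrix_mult_minus_right matrix_mul_assoc)
  then have "- (M t ** (- (P t ** G t ** P t) + V t) ** M t) = G t - M t ** V t ** M t"
    by (simp add: M_P[OF that] P_M[OF that])
  ultimately show ?thesis by (simp add: M_def[abs_def])
qed

lemma MVM_form: "0 \<le> t \<Longrightarrow> x \<bullet> ((M t ** V t ** M t) *v x) = (M t *v x) \<bullet> (V t *v (M t *v x))"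
  by (simp add: inner_symmetric_matrix[OF M_sym] flip: matrix_vector_mul_assoc)

text \<open>With \<open>?z = M 0 *v x\<close> the form equals that of \<open>P\<^sub>0\<close> at
  \<open>?z\<close>, and \<open>norm x \<le> p\<^sub>1 * norm ?z\<close>.\<close>

lemma M_0_ge: "p\<^sub>0 / p\<^sub>1\<^sup>2 * (norm x)\<^sup>2 \<le> x \<bullet> (M 0 *v x)"
proof -
  let ?z = "M 0 *v x"
  have x: "P\<^sub>0 *v ?z = x"
    using P_M[of 0] by (simp add: P_0 matrix_vector_mul_assoc)
  have "(norm x)\<^sup>2 \<le> (p\<^sub>1 * norm ?z)\<^sup>2"
    using P\<^sub>0_le[of ?z] by (simp add: x power_mono)
  then have "p\<^sub>0 / p\<^sub>1\<^sup>2 * (norm x)\<^sup>2 \<le> p\<^sub>0 / p\<^sub>1\<^sup>2 * (p\<^sub>1 * norm ?z)\<^sup>2"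
    using pos by (intro mult_left_mono) auto
  also have "\<dots> = p\<^sub>0 * (?z \<bullet> ?z)"
    using pos by (simp add: power_mult_distrib dot_square_norm)
  also have "\<dots> \<le> ?z \<bullet> (P\<^sub>0 *v ?z)"
    by (rule P\<^sub>0_ge)
  finally show ?thesis by (simp add: x inner_commute)
qed

text \<open>Closeness of the estimate to the true attitude transfers the observability of the
  true output matrix to \<open>C\<close>, which keeps the information matrix \<open>M\<close> away from \<open>0\<close>.\<close>
lemma M_ge:
  assumes close: "\<And>s. 0 \<le> s \<Longrightarrow> s \<le> T \<Longrightarrow> \<eta> s \<le> radius" and "0 \<le> T"
  shows "M_min * (norm x)\<^sup>2 \<le> x \<bullet> (M T *v x)"
proof -
  let ?k = "v\<^sub>1 / P_min"
  let ?C_true = "\<lambda>s. C_stack idx (\<lambda>i j. a i j s) (\<lambda>i. b i s) (R s)"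
  \<comment> \<open>From \<open>a\<^sup>2 \<le> 2 * u\<^sup>2 + 2 * w\<^sup>2\<close> for
    \<open>a \<le> u + w\<close>: a minorant of the form of \<open>G\<close> in which the estimate
    no longer occurs, so that its continuity and integral come from the data.\<close>
  let ?f = "\<lambda>s. q\<^sub>0 * ((norm (?C_true s *v x))\<^sup>2 / 2 - (c * (radius * norm x))\<^sup>2)"
  have "exp (- ?k * \<delta>) * min (x \<bullet> (M 0 *v x)) (q\<^sub>0 * \<mu> / 4 * (norm x)\<^sup>2) \<le> x \<bullet> (M T *v x)"
  proof (rule observability_growth[where f = ?f and g = "\<lambda>s. x \<bullet> (G s *v x)"])
    fix s assume s: "0 \<le> s" "s \<le> T"
    show "((\<lambda>s. x \<bullet> (M s *v x)) has_real_derivative x \<bullet> ((G s - M s ** V s ** M s) *v x))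
        (at s within {0..})"
      by (rule has_vector_derivative_quadratic_form[OF M_der[OF s(1)]])
    \<comment> \<open>The loss is at most \<open>v\<^sub>1\<close> times the form of the square of
      \<open>M\<close>, which \<open>M_quad\<close> bounds by the form of \<open>M\<close> divided
      by \<open>P_min\<close>.\<close>
    have "(M s *v x) \<bullet> (V s *v (M s *v x)) \<le> v\<^sub>1 * (norm (M s *v x))\<^sup>2"
      using V_le[OF s(1), of "M s *v x"] by (simp add: dot_square_norm)
    also have "\<dots> = ?k * (P_min * (norm (M s *v x))\<^sup>2)"
      using P_min_pos by simp
    also have "\<dots> \<le> ?k * (x \<bullet> (M s *v x))"
      using M_quad[OF s(1)] pos P_min_pos by (intro mult_left_mono) auto
    finally show "x \<bullet> (G s *v x) - ?k * (x \<bullet> (M s *v x)) \<le> x \<bullet> ((G s - M s ** V s ** M s) *v x)"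
      by (simp add: matrix_vector_mult_diff_rdistrib inner_diff_right MVM_form[OF s(1)])
    have "0 \<le> q\<^sub>0 * (norm (C s *v x))\<^sup>2" using pos by simp
    then show "0 \<le> x \<bullet> (G s *v x)" using G_ge[OF s(1)] by (rule order_trans)
    have "0 \<le> P_min * (norm (M s *v x))\<^sup>2" using P_min_pos by simp
    then show "0 \<le> x \<bullet> (M s *v x)" using M_quad[OF s(1)] by (rule order_trans)
    let ?u = "norm (C s *v x)" and ?w = "c * (radius * norm x)"
    have "norm (C s *v x - ?C_true s *v x) \<le> c * (\<eta> s * norm x)"
      by (rule norm_C_diff_le[OF s(1)])
    also have "\<dots> \<le> ?w"
      using close[OF s] c_pos by (intro mult_left_mono mult_right_mono) auto
    finally have "norm (?C_true s *v x) \<le> ?u + ?w"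
      using norm_triangle_ineq2[of "?C_true s *v x" "C s *v x"] by (simp add: norm_minus_commute)
    then have "(norm (?C_true s *v x))\<^sup>2 \<le> (?u + ?w)\<^sup>2"
      by (intro power_mono) auto
    also have "\<dots> \<le> 2 * ?u\<^sup>2 + 2 * ?w\<^sup>2"
      using zero_le_power2[of "?u - ?w"] unfolding power2_sum power2_diff by linarith
    finally have "?f s \<le> q\<^sub>0 * ?u\<^sup>2"
      using pos by (intro mult_left_mono) auto
    then show "?f s \<le> x \<bullet> (G s *v x)"
      using G_ge[OF s(1)] by (rule order_trans)
  next
    show cf: "continuous_on {0..} ?f"
      by (intro continuous_intros continuous_output) auto
    fix s :: real assume s: "0 \<le> s"
    have "continuous_on {s..s + \<delta>} (\<lambda>s. (norm (?C_true s *v x))\<^sup>2)"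
      by (rule continuous_on_subset[OF continuous_output]) (use s in auto)
    then have int: "(\<lambda>s. (norm (?C_true s *v x))\<^sup>2) integrable_on {s..s + \<delta>}"
      by (rule integrable_continuous_interval)
    \<comment> \<open>Of the available half of \<mu>, the choice of \<open>radius\<close> gives away
      at most a quarter.\<close>
    have "\<mu> / 4 * (norm x)\<^sup>2 \<le> \<mu> * (norm x)\<^sup>2 / 2 - \<delta> * (c\<^sup>2 * radius\<^sup>2) * (norm x)\<^sup>2"
      using mult_right_mono[OF radius_le(2), of "(norm x)\<^sup>2"] by simp
    also have "\<dots> \<le> integral {s..s + \<delta>} (\<lambda>s. (norm (?C_true s *v x))\<^sup>2) / 2
        - \<delta> * (c\<^sup>2 * radius\<^sup>2) * (norm x)\<^sup>2"
      using observable[OF s] by simp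
    also have "\<dots> = integral {s..s + \<delta>} (\<lambda>s. (norm (?C_true s *v x))\<^sup>2 / 2 - (c * (radius * norm x))\<^sup>2)"
      using int pos by (subst integral_diff) (auto simp: power_mult_distrib)
    finally have "q\<^sub>0 * (\<mu> / 4 * (norm x)\<^sup>2) \<le> integral {s..s + \<delta>} ?f"
      using pos by simp
    then show "q\<^sub>0 * \<mu> / 4 * (norm x)\<^sup>2 \<le> integral {s..s + \<delta>} ?f"
      by (simp add: mult.assoc)
  qed (use pos P_min_pos \<open>0 \<le> T\<close> in auto)
  moreover have "M_min * (norm x)\<^sup>2 = exp (- ?k * \<delta>) *
      min (p\<^sub>0 / p\<^sub>1\<^sup>2 * (norm x)\<^sup>2) (q\<^sub>0 * \<mu> / 4 * (norm x)\<^sup>2)"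
    by (simp only: M_min_def mult.assoc min_mult_distrib_right[symmetric] zero_le_power2 if_True)
      (simp add: min_mult_distrib_right)
  moreover have "\<dots> \<le> exp (- ?k * \<delta>) * min (x \<bullet> (M 0 *v x)) (q\<^sub>0 * \<mu> / 4 * (norm x)\<^sup>2)"
    by (rule mult_left_mono[OF min.mono[OF M_0_ge order_refl]]) simp
  ultimately show ?thesis by linarith
qed

end

subsection \<open>Lyapunov decay\<close>

context observer_data
begin

text \<open>Half of the damping \<open>v\<^sub>0 * M_min\<^sup>2\<close> survives the perturbation;
  \<open>P_min\<close> converts the squared norm of \<open>lam\<close> into
  \<open>L\<close>.\<close>

definition "rate = v\<^sub>0 * M_min\<^sup>2 / 2 * P_min"

definition "overshoot = 4 / sqrt (P_min * M_min)"

lemma rate_pos: "0 < rate"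
  using pos P_min_pos M_min_pos by (simp add: rate_def)

lemma overshoot_pos: "0 < overshoot"
  using P_min_pos M_min_pos by (simp add: overshoot_def)

end

context observer_trajectory
begin

text \<open>The deviation of the derivative of \<open>lam\<close> from its value \<Delta> at the
  identity.\<close>

definition "\<rho> t = (1/2) *\<^sub>R (trace (E t) *\<^sub>R \<Delta> t - E t *v \<Delta> t) - \<Delta> t"

lemma \<eta>_nonneg: "0 \<le> \<eta> t"
  by (simp add: \<eta>_def)

lemma norm_lam_le: "norm (lam t) \<le> \<eta> t"
  using norm_skew_vec_le[of "E t - mat 1"] by (simp add: lam_def \<eta>_def skew_vec_diff_mat_1)

lemma \<eta>_le: "\<lbrakk>0 \<le> t; \<eta> t \<le> 1\<rbrakk> \<Longrightarrow> \<eta> t \<le> 4 * norm (lam t)"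
  unfolding lam_def \<eta>_def by (rule norm_orthogonal_minus_mat_1_le) (auto intro: E_orthogonal)

lemma lam_der: "(lam has_vector_derivative \<Delta> t + \<rho> t) (at t within {0..})" if "0 \<le> t"
  using bounded_linear.has_vector_derivative[OF bounded_linear_skew_vec E_der[OF that]]
  by (simp add: lam_def[abs_def] \<rho>_def skew_vec_cross_mat_mult)

text \<open>Writing \<open>E\<close> as identity plus \<open>?D\<close>, the identity contributes
  exactly \<Delta> and cancels. The trace of \<open>?D\<close> costs a factor 3 and
  \<open>?D\<close> itself 1, and half of their sum is 2.\<close>

lemma norm_\<rho>_le: "norm (\<rho> t) \<le> 2 * \<eta> t * norm (\<Delta> t)"
proof -
  let ?D = "E t - mat 1"
  have "trace (E t) = trace ?D + 3"
    by (simp add: trace_def mat_def sum_3)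
  then have "\<rho> t = (1/2) *\<^sub>R (trace ?D *\<^sub>R \<Delta> t - ?D *v \<Delta> t)"
    by (simp add: \<rho>_def matrix_vector_mult_diff_rdistrib vec_eq_iff field_simps)
  moreover have "norm (trace ?D *\<^sub>R \<Delta> t) \<le> 3 * \<eta> t * norm (\<Delta> t)"
    using mult_right_mono[OF abs_trace_le[of ?D], of "norm (\<Delta> t)"] by (simp add: \<eta>_def)
  moreover have "norm (?D *v \<Delta> t) \<le> \<eta> t * norm (\<Delta> t)"
    unfolding \<eta>_def by (rule norm_matrix_vector_mult_le)
  ultimately show ?thesis
    using norm_triangle_ineq4[of "trace ?D *\<^sub>R \<Delta> t" "?D *v \<Delta> t"] by simp
qed

definition "L t = lam t \<bullet> (M t *v lam t)"

definition "L' t = 2 * ((M t *v lam t) \<bullet> (\<Delta> t + \<rho> t)) + lam t \<bullet> ((G t - M t ** V t ** M t) *v lam t)"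

lemma L_der: "(L has_real_derivative L' t) (at t within {0..})" if "0 \<le> t"
proof -
  have "(L has_vector_derivative lam t \<bullet> (M t *v (\<Delta> t + \<rho> t) + (G t - M t ** V t ** M t) *v lam t)
      + (\<Delta> t + \<rho> t) \<bullet> (M t *v lam t)) (at t within {0..})"
    unfolding L_def[abs_def]
    by (rule has_vector_derivative_inner[OF lam_der[OF that]
          has_vector_derivative_matrix_vector_mult[OF M_der[OF that] lam_der[OF that]]])
  then show ?thesis
    using inner_symmetric_matrix[OF M_sym[OF that], of "lam t" "\<Delta> t + \<rho> t"]
    by (simp add: has_real_derivative_iff_has_vector_derivative L'_def inner_add_right[of "lam t"]
        inner_commute[of "\<Delta> t + \<rho> t"] add_ac)
qed

lemma L_le: "P_min * L t \<le> (norm (lam t))\<^sup>2" if "0 \<le> t"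
proof -
  have "L t \<le> norm (lam t) * norm (M t *v lam t)"
    unfolding L_def by (rule norm_cauchy_schwarz)
  also have "\<dots> \<le> norm (lam t) * (norm (lam t) / P_min)"
    by (intro mult_left_mono norm_M_mult_le that norm_ge_zero)
  finally show ?thesis
    using P_min_pos by (simp add: field_simps power2_eq_square)
qed

context
  fixes T :: real
  assumes close: "\<And>s. 0 \<le> s \<Longrightarrow> s \<le> T \<Longrightarrow> \<eta> s \<le> radius" and T: "0 \<le> T"
begin

text \<open>The lower bound on \<open>M\<close>, tested at \<open>P T *v z\<close>, becomes an upper
  bound on the gain \<open>P\<close>.\<close>

lemma norm_P_mult_le: "M_min * norm (P T *v z) \<le> norm z"
proof (cases "P T *v z = 0")
  case False
  have "M_min * (norm (P T *v z))\<^sup>2 \<le> (P T *v z) \<bullet> z"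
    using M_ge[OF close T, of "P T *v z"] by (simp add: matrix_vector_mul_assoc M_P[OF T])
  also have "\<dots> \<le> norm (P T *v z) * norm z"
    by (rule norm_cauchy_schwarz)
  finally show ?thesis
    using False by (simp add: power2_eq_square mult.left_commute)
qed simp

lemma norm_\<Delta>_le: "M_min * norm (\<Delta> T) \<le> c\<^sup>2 * q\<^sub>1 * \<eta> T"
proof -
  have "M_min * norm (\<Delta> T) \<le> norm (transpose (C T) *v (Q T *v y T))"
    using norm_P_mult_le by (simp add: \<Delta>_def)
  also have "\<dots> \<le> c * norm (Q T *v y T)"
    by (rule norm_transpose_mult_le) (rule norm_C_le[OF T])
  also have "\<dots> \<le> c * (q\<^sub>1 * norm (y T))"
    using c_pos by (intro mult_left_mono Q_le T) simp
  also have "\<dots> \<le> c * (q\<^sub>1 * (c * \<eta> T))"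
    using c_pos pos by (intro mult_left_mono norm_y_le T) simp_all
  finally show ?thesis by (simp add: power2_eq_square mult_ac)
qed

lemma norm_lam_le_M: "M_min * norm (lam T) \<le> norm (M T *v lam T)"
proof (cases "lam T = 0")
  case False
  have "M_min * (norm (lam T))\<^sup>2 \<le> norm (lam T) * norm (M T *v lam T)"
    using M_ge[OF close T, of "lam T"] norm_cauchy_schwarz[of "lam T" "M T *v lam T"] by simp
  then show ?thesis
    using False by (simp add: power2_eq_square mult.left_commute)
qed simp

text \<open>The innovation contributes minus twice the form of \<open>G\<close> at
  \<open>lam T\<close>, while the derivative of \<open>M\<close> gives it back once, so a
  nonpositive term remains and is dropped. Decay comes from the loss term with \<open>V\<close>,
  bounded below through \<open>M_min\<close>; the linearization error of the outputs and \<rho>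
  consume at most half of it.\<close>

lemma L'_le: "L' T \<le> - rate * L T"
proof -
  let ?l = "lam T" and ?n = "norm (lam T)"
  let ?e = "y T - C T *v ?l"
  have "(M T *v ?l) \<bullet> \<Delta> T = - ((P T *v (M T *v ?l)) \<bullet> (transpose (C T) *v (Q T *v y T)))"
    by (simp add: \<Delta>_def inner_symmetric_matrix[OF P_sym[OF T]])
  also have "P T *v (M T *v ?l) = ?l"
    by (simp add: matrix_vector_mul_assoc P_M[OF T])
  also have "?l \<bullet> (transpose (C T) *v (Q T *v y T)) = (C T *v ?l) \<bullet> (Q T *v (C T *v ?l + ?e))"
    by (simp add: inner_matrix_transpose)
  finally have main: "(M T *v ?l) \<bullet> \<Delta> T
      = - ((C T *v ?l) \<bullet> (Q T *v (C T *v ?l))) - (C T *v ?l) \<bullet> (Q T *v ?e)"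
    by (simp only: matrix_vector_right_distrib inner_add_right)
  have "0 \<le> q\<^sub>0 * (norm (C T *v ?l))\<^sup>2" using pos by simp
  then have CQC: "0 \<le> (C T *v ?l) \<bullet> (Q T *v (C T *v ?l))"
    using Q_ge[OF T] by (rule order_trans)
  \<comment> \<open>One factor is bounded by \<open>radius\<close> and supplies smallness, the other
    is exchanged for the norm of \<open>lam T\<close>.\<close>
  have quadratic: "(\<eta> T)\<^sup>2 \<le> 4 * radius * ?n"
  proof -
    have "\<eta> T \<le> 4 * ?n"
      using close[OF T order_refl] radius_le(1) by (intro \<eta>_le T) simp
    then have "\<eta> T * \<eta> T \<le> radius * (4 * ?n)"
      using close[OF T order_refl] \<eta>_nonneg radius_pos by (intro mult_mono) auto
    then show ?thesis by (simp add: power2_eq_square mult_ac)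
  qed
  have "- ((C T *v ?l) \<bullet> (Q T *v ?e)) \<le> norm (C T *v ?l) * norm (Q T *v ?e)"
    using Cauchy_Schwarz_ineq2[of "C T *v ?l" "Q T *v ?e"] by simp
  also have "\<dots> \<le> (c * ?n) * (q\<^sub>1 * (c * ((\<eta> T)\<^sup>2 / 2)))"
    using pos c_pos y_linearization[OF T]
    by (intro mult_mono norm_C_le T order_trans[OF Q_le[OF T]] mult_left_mono) auto
  also have "\<dots> = c\<^sup>2 * q\<^sub>1 / 2 * ?n * (\<eta> T)\<^sup>2"
    by (simp add: power2_eq_square)
  finally have output_part: "- ((C T *v ?l) \<bullet> (Q T *v ?e)) \<le> c\<^sup>2 * q\<^sub>1 / 2 * ?n * (\<eta> T)\<^sup>2" .
  have "(M T *v ?l) \<bullet> \<rho> T \<le> norm (M T *v ?l) * norm (\<rho> T)"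
    by (rule norm_cauchy_schwarz)
  also have "\<dots> \<le> (?n / P_min) * (2 * \<eta> T * (c\<^sup>2 * q\<^sub>1 * \<eta> T / M_min))"
  proof (intro mult_mono norm_M_mult_le T)
    have "norm (\<Delta> T) \<le> c\<^sup>2 * q\<^sub>1 * \<eta> T / M_min"
      using norm_\<Delta>_le M_min_pos by (simp add: pos_le_divide_eq mult.commute)
    then have "2 * \<eta> T * norm (\<Delta> T) \<le> 2 * \<eta> T * (c\<^sup>2 * q\<^sub>1 * \<eta> T / M_min)"
      using \<eta>_nonneg by (intro mult_left_mono) auto
    with norm_\<rho>_le show "norm (\<rho> T) \<le> 2 * \<eta> T * (c\<^sup>2 * q\<^sub>1 * \<eta> T / M_min)"
      by (rule order_trans)
  qed (use P_min_pos in auto)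
  also have "\<dots> = 2 * (c\<^sup>2 * q\<^sub>1) / (P_min * M_min) * ?n * (\<eta> T)\<^sup>2"
    by (simp add: power2_eq_square)
  finally have kinematic_part: "(M T *v ?l) \<bullet> \<rho> T
      \<le> 2 * (c\<^sup>2 * q\<^sub>1) / (P_min * M_min) * ?n * (\<eta> T)\<^sup>2" .
  have "2 * (c\<^sup>2 * q\<^sub>1 / 2 * ?n * (\<eta> T)\<^sup>2) + 2 * (2 * (c\<^sup>2 * q\<^sub>1) / (P_min * M_min) * ?n * (\<eta> T)\<^sup>2)
      = (c\<^sup>2 * q\<^sub>1 + 4 * (c\<^sup>2 * q\<^sub>1) / (P_min * M_min)) * ?n * (\<eta> T)\<^sup>2"
    by (simp add: distrib_right)
  also have "\<dots> \<le> (c\<^sup>2 * q\<^sub>1 + 4 * (c\<^sup>2 * q\<^sub>1) / (P_min * M_min)) * ?n * (4 * radius * ?n)"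
    using pos P_min_pos M_min_pos by (intro mult_left_mono quadratic) auto
  also have "\<dots> = K * radius * ?n\<^sup>2"
    by (simp add: K_def power2_eq_square algebra_simps)
  also have "\<dots> \<le> v\<^sub>0 * M_min\<^sup>2 / 2 * ?n\<^sup>2"
    by (intro mult_right_mono radius_le) simp
  finally have perturbation: "2 * (c\<^sup>2 * q\<^sub>1 / 2 * ?n * (\<eta> T)\<^sup>2)
      + 2 * (2 * (c\<^sup>2 * q\<^sub>1) / (P_min * M_min) * ?n * (\<eta> T)\<^sup>2) \<le> v\<^sub>0 * M_min\<^sup>2 / 2 * ?n\<^sup>2" .
  have "(M_min * ?n)\<^sup>2 \<le> (norm (M T *v ?l))\<^sup>2"
    using norm_lam_le_M M_min_pos by (intro power_mono) auto
  then have "v\<^sub>0 * M_min\<^sup>2 * ?n\<^sup>2 \<le> v\<^sub>0 * (norm (M T *v ?l))\<^sup>2"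
    using pos by (simp add: power_mult_distrib)
  also have "\<dots> \<le> (M T *v ?l) \<bullet> (V T *v (M T *v ?l))"
    using V_ge[OF T, of "M T *v ?l"] by (simp add: dot_square_norm)
  finally have damping: "v\<^sub>0 * M_min\<^sup>2 * ?n\<^sup>2 \<le> (M T *v ?l) \<bullet> (V T *v (M T *v ?l))" .
  have "L' T = 2 * ((M T *v ?l) \<bullet> \<Delta> T) + 2 * ((M T *v ?l) \<bullet> \<rho> T)
      + (C T *v ?l) \<bullet> (Q T *v (C T *v ?l)) - (M T *v ?l) \<bullet> (V T *v (M T *v ?l))"
    by (simp add: L'_def inner_add_right matrix_vector_mult_diff_rdistrib inner_diff_right
        G_form MVM_form[OF T])
  then have "L' T \<le> - (v\<^sub>0 * M_min\<^sup>2 / 2 * ?n\<^sup>2)"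
    using main CQC output_part kinematic_part perturbation damping by simp
  also have "\<dots> \<le> - (v\<^sub>0 * M_min\<^sup>2 / 2 * (P_min * L T))"
    using mult_left_mono[OF L_le[OF T], of "v\<^sub>0 * M_min\<^sup>2 / 2"] pos by simp
  finally show ?thesis by (simp add: rate_def)
qed

end

text \<open>Gronwall for \<open>L\<close> is translated to \<eta> by bounding \<open>L\<close> above
  and below by squared norms of \<open>lam\<close>; the ratio of these bounds and the factor 4
  between \<eta> and \<open>lam\<close> form \<open>overshoot\<close>.\<close>

lemma error_decay:
  assumes close: "\<And>s. 0 \<le> s \<Longrightarrow> s \<le> T \<Longrightarrow> \<eta> s \<le> radius" and T: "0 \<le> T"
  shows "\<eta> T \<le> overshoot * exp (- (rate / 2) * T) * \<eta> 0"
proof -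
  let ?n = "norm (lam T)" and ?init = "norm (lam 0)"
  have "L T \<le> exp (- rate * (T - 0)) * L 0"
  proof (rule differential_Gronwall[OF order_refl T L_der])
    show "L' s \<le> - rate * L s" if "0 \<le> s" "s \<le> T" for s
      by (rule L'_le) (use close that in auto)
  qed
  then have "P_min * L T \<le> exp (- rate * T) * (P_min * L 0)"
    using P_min_pos by simp
  also have "\<dots> \<le> exp (- rate * T) * ?init\<^sup>2"
    by (intro mult_left_mono L_le) auto
  finally have "P_min * L T \<le> exp (- rate * T) * ?init\<^sup>2" .
  moreover have "P_min * (M_min * ?n\<^sup>2) \<le> P_min * L T"
    using P_min_pos M_ge[OF close T, of "lam T"] by (simp add: L_def)
  ultimately have "P_min * M_min * ?n\<^sup>2 \<le> exp (- rate * T) * ?init\<^sup>2"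
    by simp
  \<comment> \<open>\<open>L\<close> is quadratic in the error, so the square root halves the
    rate.\<close>
  also have "exp (- rate * T) = (exp (- (rate / 2) * T))\<^sup>2"
    by (simp flip: exp_double)
  finally have "(sqrt (P_min * M_min) * ?n)\<^sup>2 \<le> (exp (- (rate / 2) * T) * ?init)\<^sup>2"
    using P_min_pos M_min_pos by (simp add: power_mult_distrib)
  then have "sqrt (P_min * M_min) * ?n \<le> exp (- (rate / 2) * T) * ?init"
    by (rule power2_le_imp_le) simp
  then have "4 * ?n \<le> overshoot * (exp (- (rate / 2) * T) * ?init)"
    using P_min_pos M_min_pos by (simp add: overshoot_def field_simps)
  also have "\<dots> \<le> overshoot * (exp (- (rate / 2) * T) * \<eta> 0)"
    using overshoot_pos by (intro mult_left_mono norm_lam_le) auto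
  finally show ?thesis
    using \<eta>_le[OF T] close[OF T order_refl] radius_le(1) by simp
qed

text \<open>The decay estimate presupposes closeness up to the time considered and returns
  \<open>\<eta> T \<le> overshoot * \<eta> 0\<close>. The initial bound puts both
  \<open>\<eta> 0\<close> and this product strictly below \<open>radius\<close>, which is what the
  continuity argument requires.\<close>

lemma exponential_decay:
  assumes small: "\<eta> 0 \<le> radius / (2 * (1 + overshoot))" and t: "0 \<le> t"
  shows "\<eta> t \<le> overshoot * exp (- (rate / 2) * t) * \<eta> 0"
proof (rule error_decay[OF _ t])
  have "2 * (1 + overshoot) * \<eta> 0 \<le> radius"
    using small overshoot_pos by (simp add: field_simps)
  moreover have "0 \<le> overshoot * \<eta> 0"
    using overshoot_pos \<eta>_nonneg by simp
  ultimately have initial: "\<eta> 0 < radius" "overshoot * \<eta> 0 < radius"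
    using radius_pos \<eta>_nonneg[of 0] by (auto simp: algebra_simps)
  have "continuous_on {0..} E"
    using E_der by (intro continuous_on_vector_derivative) auto
  then have cont: "continuous_on {0..} \<eta>"
    unfolding \<eta>_def[abs_def] by (intro continuous_intros)
  show "\<eta> s \<le> radius" if "0 \<le> s" for s
  proof (rule less_imp_le, rule continuous_bootstrap[OF cont initial(1) _ that])
    fix T assume T: "0 \<le> T" and close: "\<And>s. 0 \<le> s \<Longrightarrow> s \<le> T \<Longrightarrow> \<eta> s \<le> radius"
    have "\<eta> T \<le> overshoot * exp (- (rate / 2) * T) * \<eta> 0"
      by (rule error_decay[OF close T])
    also have "\<dots> \<le> overshoot * 1 * \<eta> 0"
      using overshoot_pos rate_pos T \<eta>_nonneg by (intro mult_right_mono mult_left_mono) auto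
    finally show "\<eta> T < radius"
      using initial(2) by simp
  qed
qed

end

lemma (in observer_data) locally_exp_stable:
  "locally_exp_stable (mat 1)
    {(\<lambda>t. Rh t ** transpose (R t)) | Rh P. riccati_observer idx \<Omega> a b Q V P\<^sub>0 R Rh P}"
  (is "locally_exp_stable _ ?\<X>")
proof -
  have "norm (x t - mat 1) \<le> overshoot * exp (- (rate / 2) * t) * norm (x 0 - mat 1)"
    if "x \<in> ?\<X>" and small: "norm (x 0 - mat 1) \<le> radius / (2 * (1 + overshoot))" and t: "0 \<le> t"
    for x t
  proof -
    obtain Rh P where x: "x = (\<lambda>t. Rh t ** transpose (R t))"
      and "riccati_observer idx \<Omega> a b Q V P\<^sub>0 R Rh P"
      using \<open>x \<in> ?\<X>\<close> by auto
    then interpret observer_trajectory idx a b \<Omega> R Q V P\<^sub>0 B q\<^sub>0 q\<^sub>1 v\<^sub>0 v\<^sub>1 p\<^sub>0 p\<^sub>1 \<delta> \<mu> Rh P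
      by unfold_locales
    show ?thesis
      using exponential_decay[OF _ t] small by (simp add: \<eta>_def E_def x)
  qed
  moreover have "0 < radius / (2 * (1 + overshoot))" "0 < rate / 2"
    using radius_pos overshoot_pos rate_pos by auto
  ultimately show ?thesis
    unfolding locally_exp_stable_def using overshoot_pos by blast
qed

subsection \<open>The observability Gramian\<close>

lemma loewner_ge_scaleR_mat_1D:
  fixes A :: "real^'n^'n"
  assumes "loewner_ge A (e *\<^sub>R mat 1)"
  shows "transpose A = A" and "e * (x \<bullet> x) \<le> x \<bullet> (A *v x)"
proof -
  have "transpose (A - e *\<^sub>R mat 1) = transpose A - e *\<^sub>R mat 1"
    by (simp add: vec_eq_iff transpose_def mat_def)
  then show "transpose A = A"
    using assms by (simp add: loewner_ge_def pos_semidef_def)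
  have "0 \<le> x \<bullet> ((A - e *\<^sub>R mat 1) *v x)"
    using assms by (simp add: loewner_ge_def pos_semidef_def)
  then show "e * (x \<bullet> x) \<le> x \<bullet> (A *v x)"
    by (simp add: matrix_vector_mult_diff_rdistrib inner_diff_right flip: scaleR_matrix_vector_assoc)
qed

text \<open>The form attains its minimum on the compact unit sphere, and this minimum is
  positive.\<close>

lemma pos_def_bound:
  fixes A :: "real^'n^'n"
  assumes "pos_def A"
  obtains e where "0 < e" "\<And>x. e * (x \<bullet> x) \<le> x \<bullet> (A *v x)"
proof -
  have "continuous_on (sphere 0 1) (\<lambda>x. x \<bullet> (A *v x))"
    by (intro continuous_on_inner continuous_on_id matrix_vector_mult_linear_continuous_on)
  moreover have "axis undefined 1 \<in> (sphere 0 1 :: (real^'n) set)" by simp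
  ultimately obtain z :: "real^'n" where z: "norm z = 1"
    and le: "\<And>y. norm y = 1 \<Longrightarrow> z \<bullet> (A *v z) \<le> y \<bullet> (A *v y)"
    using continuous_attains_inf[of "sphere 0 1 :: (real^'n) set" "\<lambda>x. x \<bullet> (A *v x)"]
    by (metis compact_sphere empty_iff mem_sphere_0)
  have "z \<noteq> 0" using z by auto
  then have "0 < z \<bullet> (A *v z)"
    using assms by (simp add: pos_def_def)
  then show thesis
    using quadratic_form_ge[OF le] that by blast
qed

lemma bounded_continuous_boundE:
  assumes "bounded_continuous f"
  obtains B where "0 < B" "\<And>t. 0 \<le> t \<Longrightarrow> norm (f t) \<le> B"
  using assms unfolding bounded_continuous_def bounded_pos by auto

section \<open>The Gramian integrand as a squared output norm\<close>

lemma bounded_linear_cross_mat: "bounded_linear cross_mat"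
proof (rule bounded_linear_intro[where K = 2])
  show "norm (cross_mat w) \<le> norm w * 2" for w
    using norm_cross_mat_le[of w] by simp
qed (simp_all add: vec_eq_iff forall_3 cross_mat_nth)

lemma column_gram_mult: "column_gram N a *v z = (\<Sum>j=1..N. (a j \<bullet> z) *\<^sub>R a j)"
proof -
  have "(\<Sum>s\<in>UNIV. (\<Sum>j=1..N. a j $ r * a j $ s) * z $ s) = (\<Sum>j=1..N. (a j \<bullet> z) * a j $ r)" for r
    by (subst sum_distrib_right, subst sum.swap)
      (simp add: inner_vec_def sum_distrib_left sum_distrib_right mult_ac)
  then show ?thesis
    by (simp add: vec_eq_iff column_gram_def matrix_vector_mult_def)
qed

text \<open>Moving the left \<open>cross_mat b\<close> to the other side of the inner product
  changes the sign because it is skew; this explains the minus sign in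
  \<open>obs_gramian\<close>.\<close>

lemma gramian_integrand_form:
  "x \<bullet> ((cross_mat b ** R ** column_gram N a ** transpose R ** cross_mat b) *v x)
    = - (\<Sum>j=1..N. (a j \<bullet> (transpose R *v cross3 b x))\<^sup>2)"
proof -
  let ?z = "transpose R *v cross3 b x"
  have "x \<bullet> (cross_mat b *v (R *v (column_gram N a *v ?z)))
      = - ((cross_mat b *v x) \<bullet> (R *v (column_gram N a *v ?z)))"
    by (simp add: inner_matrix_transpose transpose_cross_mat matrix_vector_mult_minus_left)
  also have "(cross_mat b *v x) \<bullet> (R *v (column_gram N a *v ?z)) = ?z \<bullet> (column_gram N a *v ?z)"
    by (simp add: inner_matrix_transpose cross_mat_mult)
  also have "\<dots> = (\<Sum>j=1..N. (a j \<bullet> ?z)\<^sup>2)"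
    by (simp add: column_gram_mult inner_sum_right power2_eq_square inner_commute)
  finally show ?thesis
    by (simp add: cross_mat_mult flip: matrix_vector_mul_assoc)
qed

lemma norm_C_stack_mult_sq:
  assumes "row_numbering p n idx"
  shows "(norm (C_stack idx a b R *v x))\<^sup>2
    = (\<Sum>i=1..p. \<Sum>j=1..n i. (a i j \<bullet> (transpose R *v cross3 (b i) x))\<^sup>2)"
proof -
  let ?f = "\<lambda>(i, j). (a i j \<bullet> (transpose R *v cross3 (b i) x))\<^sup>2"
  have "(norm (C_stack idx a b R *v x))\<^sup>2 = (\<Sum>k\<in>UNIV. ?f (idx k))"
    unfolding dot_square_norm[symmetric]
    by (subst inner_vec_def) (simp add: C_stack_mult_nth power2_eq_square case_prod_beta)
  also have "\<dots> = sum ?f (SIGMA i:{1..p}. {1..n i})"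
    using assms unfolding row_numbering_def by (rule sum.reindex_bij_betw)
  also have "\<dots> = (\<Sum>i=1..p. \<Sum>j=1..n i. (a i j \<bullet> (transpose R *v cross3 (b i) x))\<^sup>2)"
    by (subst sum.Sigma) auto
  finally show ?thesis .
qed

theorem lemma1:
  fixes p :: nat and n :: "nat \<Rightarrow> nat" and idx :: "'m::finite \<Rightarrow> nat \<times> nat"
    and \<Omega> :: "real \<Rightarrow> real^3" and R :: "real \<Rightarrow> real^3^3"
    and a :: "nat \<Rightarrow> nat \<Rightarrow> real \<Rightarrow> real^3" and b :: "nat \<Rightarrow> real \<Rightarrow> real^3"
    and Q :: "real \<Rightarrow> real^'m^'m" and V :: "real \<Rightarrow> real^3^3" and P\<^sub>0 :: "real^3^3"
    and \<delta> \<mu> :: real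
  assumes "\<And>i. i \<in> {1..p} \<Longrightarrow> n i \<ge> 1"
    and "row_numbering p n idx"
    and "attitude_system \<Omega> R"
    and "bounded_continuous Q" and "pos_def_fun Q"
    and "bounded_continuous V" and "pos_def_fun V"
    and "pos_def P\<^sub>0"
    and "bounded_continuous \<Omega>"
    and "\<And>i j. i \<in> {1..p} \<Longrightarrow> j \<in> {1..n i} \<Longrightarrow> bounded_continuous (a i j)"
    and "\<And>i. i \<in> {1..p} \<Longrightarrow> bounded_continuous (b i)"
    and "\<delta> > 0" and "\<mu> > 0"
    and "\<And>t. t \<ge> 0 \<Longrightarrow> loewner_ge (obs_gramian p n a b R t (t + \<delta>)) (\<mu> *\<^sub>R mat 1)"
  shows "locally_exp_stable (mat 1)
           {(\<lambda>t. Rh t ** transpose (R t)) | Rh P. riccati_observer idx \<Omega> a b Q V P\<^sub>0 R Rh P}"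
proof -
  note numbering = assms(2) and attitude = assms(3) and a = assms(10) and b = assms(11)
    and gramian = assms(14)
  have idx: "fst (idx k) \<in> {1..p}" "snd (idx k) \<in> {1..n (fst (idx k))}" for k
    using numbering unfolding row_numbering_def
    by (metis UNIV_I bij_betwE mem_Sigma_iff prod.collapse)+
  have "\<exists>B>0. \<forall>t\<ge>0. norm (a (fst (idx k)) (snd (idx k)) t) \<le> B \<and> norm (b (fst (idx k)) t) \<le> B" for k
  proof -
    obtain B\<^sub>a B\<^sub>b where "0 < B\<^sub>a" "0 < B\<^sub>b" "\<And>t. 0 \<le> t \<Longrightarrow> norm (a (fst (idx k)) (snd (idx k)) t) \<le> B\<^sub>a"
      "\<And>t. 0 \<le> t \<Longrightarrow> norm (b (fst (idx k)) t) \<le> B\<^sub>b"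
      using a[OF idx] b[OF idx(1)] by (metis bounded_continuous_boundE)
    then show ?thesis
      by (intro exI[of _ "max B\<^sub>a B\<^sub>b"]) (auto simp: le_max_iff_disj)
  qed
  then obtain \<beta> where \<beta>: "\<And>k. 0 < \<beta> k"
    "\<And>k t. 0 \<le> t \<Longrightarrow> norm (a (fst (idx k)) (snd (idx k)) t) \<le> \<beta> k \<and> norm (b (fst (idx k)) t) \<le> \<beta> k"
    by metis
  \<comment> \<open>The sum dominates each of its positive summands, giving one bound for all
    finitely many rows.\<close>
  define B where "B = 1 + (\<Sum>k\<in>UNIV. \<beta> k)"
  have \<beta>_le: "\<beta> k \<le> B" for k
    using member_le_sum[of k UNIV \<beta>] \<beta>(1) by (simp add: B_def less_imp_le)
  obtain q\<^sub>0 where q\<^sub>0: "0 < q\<^sub>0" "\<And>t. 0 \<le> t \<Longrightarrow> loewner_ge (Q t) (q\<^sub>0 *\<^sub>R mat 1)"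
    using assms(5) by (auto simp: pos_def_fun_def)
  obtain v\<^sub>0 where v\<^sub>0: "0 < v\<^sub>0" "\<And>t. 0 \<le> t \<Longrightarrow> loewner_ge (V t) (v\<^sub>0 *\<^sub>R mat 1)"
    using assms(7) by (auto simp: pos_def_fun_def)
  obtain q\<^sub>1 where q\<^sub>1: "0 < q\<^sub>1" "\<And>t. 0 \<le> t \<Longrightarrow> norm (Q t) \<le> q\<^sub>1"
    using bounded_continuous_boundE[OF assms(4)] by blast
  obtain v\<^sub>1 where v\<^sub>1: "0 < v\<^sub>1" "\<And>t. 0 \<le> t \<Longrightarrow> norm (V t) \<le> v\<^sub>1"
    using bounded_continuous_boundE[OF assms(6)] by blast
  obtain p\<^sub>0 where p\<^sub>0: "0 < p\<^sub>0" "\<And>x. p\<^sub>0 * (x \<bullet> x) \<le> x \<bullet> (P\<^sub>0 *v x)"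
    using pos_def_bound[OF assms(8)] by blast
  have cont_R: "continuous_on {0..} R"
    using attitude by (intro continuous_on_vector_derivative) (auto simp: attitude_system_def)
  have cont_a: "continuous_on {0..} (a i j)" if "i \<in> {1..p}" "j \<in> {1..n i}" for i j
    using a[OF that] by (simp add: bounded_continuous_def)
  have cont_b: "continuous_on {0..} (b i)" if "i \<in> {1..p}" for i
    using b[OF that] by (simp add: bounded_continuous_def)
  note cont_mult = bounded_bilinear.continuous_on[OF bounded_bilinear_matrix_matrix_mult]
  have cont_cross: "continuous_on {0..} (\<lambda>s. cross_mat (b i s))" if "i \<in> {1..p}" for i
    by (rule bounded_linear.continuous_on[OF bounded_linear_cross_mat cont_b[OF that]])
  have cont_RT: "continuous_on {0..} (\<lambda>s. transpose (R s))"
    by (rule bounded_linear.continuous_on[OF bounded_linear_transpose cont_R])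
  let ?F = "\<lambda>s. \<Sum>i=1..p. cross_mat (b i s) ** R s ** column_gram (n i) (\<lambda>j. a i j s) ** transpose (R s)
    ** cross_mat (b i s)"
  have cont_F: "continuous_on {0..} ?F"
    unfolding column_gram_def
    by (intro continuous_on_sum cont_mult cont_cross cont_R cont_RT continuous_on_vec_lambda
        continuous_on_mult continuous_on_component cont_a) auto
  let ?C = "\<lambda>s. C_stack idx (\<lambda>i j. a i j s) (\<lambda>i. b i s) (R s)"
  have F_form: "x \<bullet> (?F s *v x) = - (norm (?C s *v x))\<^sup>2" for x s
  proof -
    have "x \<bullet> (?F s *v x) = (\<Sum>i=1..p. x \<bullet> ((cross_mat (b i s) ** R s ** column_gram (n i) (\<lambda>j. a i j s)
        ** transpose (R s) ** cross_mat (b i s)) *v x))"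
      by (simp add: bounded_bilinear.sum_left[OF bounded_bilinear_matrix_vector_mult] inner_sum_right)
    then show ?thesis
      by (simp only: gramian_integrand_form norm_C_stack_mult_sq[OF numbering] sum_negf)
  qed
  \<comment> \<open>Evaluation of a quadratic form at a fixed vector is linear in the matrix, hence
    preserves continuity and commutes with the integral of \<open>?F\<close>.\<close>
  have linear_form: "bounded_linear (\<lambda>A. x \<bullet> (A *v x))" for x :: "real^3"
    by (rule bounded_linear_compose[OF bounded_linear_inner_right
          bounded_bilinear.bounded_linear_left[OF bounded_bilinear_matrix_vector_mult]])
  \<comment> \<open>The factor \<delta> undoes the averaging in \<open>obs_gramian\<close>; adding 1
    to the norm of \<open>P\<^sub>0\<close> yields a positive bound at once.\<close>
  interpret observer_data idx a b \<Omega> R Q V P\<^sub>0 B q\<^sub>0 q\<^sub>1 v\<^sub>0 v\<^sub>1 p\<^sub>0 "norm P\<^sub>0 + 1" \<delta> "\<delta> * \<mu>"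
  proof
    show "attitude_system \<Omega> R" by fact
    show "transpose P\<^sub>0 = P\<^sub>0" using assms(8) by (simp add: pos_def_def)
    show "p\<^sub>0 * (x \<bullet> x) \<le> x \<bullet> (P\<^sub>0 *v x)" for x by (rule p\<^sub>0)
    show "norm (P\<^sub>0 *v x) \<le> (norm P\<^sub>0 + 1) * norm x" for x
      using norm_matrix_vector_mult_le[of P\<^sub>0 x] norm_ge_zero[of x]
      unfolding distrib_right by linarith
    show "0 < B" using \<beta>(1) by (simp add: B_def add_pos_nonneg sum_nonneg less_imp_le)
    show "0 < q\<^sub>0" "0 < q\<^sub>1" "0 < v\<^sub>0" "0 < v\<^sub>1" "0 < p\<^sub>0" "0 < \<delta>" by fact+
    show "0 < norm P\<^sub>0 + 1" using norm_ge_zero[of P\<^sub>0] by linarith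
    show "0 < \<delta> * \<mu>" using assms(12,13) by simp
    have "continuous_on {0..} (\<lambda>s. - (x \<bullet> (?F s *v x)))" for x
      by (intro continuous_on_minus bounded_linear.continuous_on[OF linear_form] cont_F)
    then show "continuous_on {0..} (\<lambda>s. (norm (?C s *v x))\<^sup>2)" for x
      by (simp only: F_form minus_minus)
    fix t :: real assume t: "0 \<le> t"
    show "norm (a (fst (idx k)) (snd (idx k)) t) \<le> B" "norm (b (fst (idx k)) t) \<le> B" for k
      using \<beta>(2)[OF t, of k] \<beta>_le[of k] by auto
    show "transpose (Q t) = Q t" "transpose (V t) = V t"
      using loewner_ge_scaleR_mat_1D(1) q\<^sub>0(2)[OF t] v\<^sub>0(2)[OF t] by blast+
    show "q\<^sub>0 * (norm y)\<^sup>2 \<le> y \<bullet> (Q t *v y)" for y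
      using loewner_ge_scaleR_mat_1D(2)[OF q\<^sub>0(2)[OF t]] by (simp add: dot_square_norm)
    show "v\<^sub>0 * (x \<bullet> x) \<le> x \<bullet> (V t *v x)" for x
      by (rule loewner_ge_scaleR_mat_1D(2)[OF v\<^sub>0(2)[OF t]])
    show "norm (Q t *v y) \<le> q\<^sub>1 * norm y" for y
      by (rule order_trans[OF norm_matrix_vector_mult_le mult_right_mono[OF q\<^sub>1(2)[OF t] norm_ge_zero]])
    show "x \<bullet> (V t *v x) \<le> v\<^sub>1 * (x \<bullet> x)" for x
    proof -
      have "x \<bullet> (V t *v x) \<le> norm x * norm (V t *v x)"
        by (rule norm_cauchy_schwarz)
      also have "\<dots> \<le> norm x * (v\<^sub>1 * norm x)"
        by (intro mult_left_mono norm_ge_zero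
            order_trans[OF norm_matrix_vector_mult_le mult_right_mono[OF v\<^sub>1(2)[OF t] norm_ge_zero]])
      finally show ?thesis by (simp add: dot_square_norm power2_eq_square mult_ac)
    qed
    show "\<delta> * \<mu> * (norm x)\<^sup>2 \<le> integral {t..t + \<delta>} (\<lambda>s. (norm (?C s *v x))\<^sup>2)" for x
    proof -
      have "continuous_on {t..t + \<delta>} ?F"
        by (rule continuous_on_subset[OF cont_F]) (use t in auto)
      then have int: "?F integrable_on {t..t + \<delta>}"
        by (rule integrable_continuous_interval)
      have "\<mu> * (norm x)\<^sup>2 \<le> x \<bullet> (obs_gramian p n a b R t (t + \<delta>) *v x)"
        using loewner_ge_scaleR_mat_1D(2)[OF gramian[OF t]] by (simp add: dot_square_norm)
      also have "\<dots> = - (1 / \<delta>) * (x \<bullet> (integral {t..t + \<delta>} ?F *v x))"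
        unfolding obs_gramian_def
        by (simp add: matrix_vector_mult_minus_left flip: scaleR_matrix_vector_assoc)
      also have "x \<bullet> (integral {t..t + \<delta>} ?F *v x) = integral {t..t + \<delta>} (\<lambda>s. x \<bullet> (?F s *v x))"
        using integral_linear[OF int linear_form[of x]] by (simp add: o_def)
      also have "\<dots> = - integral {t..t + \<delta>} (\<lambda>s. (norm (?C s *v x))\<^sup>2)"
        by (simp only: F_form integral_neg)
      finally show ?thesis
        using \<open>\<delta> > 0\<close> by (simp add: field_simps)
    qed
  qed
  show ?thesis by (rule locally_exp_stable)
qed

end
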